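(* The asymptotic leading order of the sequence $C_n$ is upper bounded as $$\log C_n\le 2n\log(n)+O(n)\qquad\text{as } n\to\infty .$$
   Context: $C_n$ (for $n\ge 2$) is the number of lines contained in a generic hypersurface of degree $2n-3$ in complex projective space $\mathbb{CP}^n$. Equivalently, $C_n=\int_{\mathbb{G}r(1,n)}c_{2n-2}(\mathrm{Sym}^{2n-3}(S^\ast))$, where $\mathbb{G}r(1,n)=Gr(2,n+1)$ is the Grassmannian of projective lines in $\mathbb{CP}^n$ and $S^\ast$ is the dual of its rank-2 universal subbundle. *)

theory Defs
  imports Complex_Main "HOL-Library.Poly_Mapping" "HOL-Library.Landau_Symbols"
begin

section \<open>Multivariate polynomials over the complex numbers\<close>

text \<open>
  A monomial with variables in \<open>'v\<close> is a finitely supported exponent function, and a polynomial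
  is a finitely supported function from monomials to coefficients.
\<close>

type_synonym 'v cpoly = "('v \<Rightarrow>\<^sub>0 nat) \<Rightarrow>\<^sub>0 complex"

definition poly_eval :: "'v cpoly \<Rightarrow> ('v \<Rightarrow> complex) \<Rightarrow> complex" where
  "poly_eval p x =
     (\<Sum>m\<in>Poly_Mapping.keys p.
        Poly_Mapping.lookup p m * (\<Prod>i\<in>Poly_Mapping.keys m. x i ^ Poly_Mapping.lookup m i))"

definition monomials :: "nat \<Rightarrow> nat \<Rightarrow> (nat \<Rightarrow>\<^sub>0 nat) set" where
  "monomials n d =
     {m. Poly_Mapping.keys m \<subseteq> {..n} \<and> (\<Sum>i\<le>n. Poly_Mapping.lookup m i) = d}"

text \<open>Homogeneous polynomials of degree \<open>d\<close> in the \<open>n + 1\<close> variables \<open>0, \<dots>, n\<close>, including \<open>0\<close>.\<close>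

definition forms :: "nat \<Rightarrow> nat \<Rightarrow> nat cpoly set" where
  "forms n d = {F. Poly_Mapping.keys F \<subseteq> monomials n d}"


section \<open>Lines and hypersurfaces in complex projective space\<close>

text \<open>
  The dimension \<open>n\<close> has to vary, so a vector of \<open>\<complex>\<^bsup>n+1\<^esup>\<close> is a function on the naturals that
  vanishes above \<open>n\<close>.
\<close>

definition nonzero_vecs :: "nat \<Rightarrow> (nat \<Rightarrow> complex) set" where
  "nonzero_vecs n = {x. (\<forall>i>n. x i = 0) \<and> (\<exists>i. x i \<noteq> 0)}"

definition proj_point :: "(nat \<Rightarrow> complex) \<Rightarrow> (nat \<Rightarrow> complex) set" where
  "proj_point x = {(\<lambda>i. c * x i) | c. c \<noteq> 0}"

definition CP :: "nat \<Rightarrow> (nat \<Rightarrow> complex) set set" where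
  "CP n = proj_point ` nonzero_vecs n"

text \<open>The line through the points with homogeneous coordinates \<open>x\<close> and \<open>y\<close>.\<close>

definition proj_line_through ::
    "(nat \<Rightarrow> complex) \<Rightarrow> (nat \<Rightarrow> complex) \<Rightarrow> (nat \<Rightarrow> complex) set set" where
  "proj_line_through x y = {proj_point (\<lambda>i. a * x i + b * y i) | a b. a \<noteq> 0 \<or> b \<noteq> 0}"

definition proj_lines :: "nat \<Rightarrow> (nat \<Rightarrow> complex) set set set" where
  "proj_lines n =
     {proj_line_through x y | x y.
        x \<in> nonzero_vecs n \<and> y \<in> nonzero_vecs n \<and> proj_point x \<noteq> proj_point y}"

definition hypersurface :: "nat \<Rightarrow> nat cpoly \<Rightarrow> (nat \<Rightarrow> complex) set set" where
  "hypersurface n F = {P \<in> CP n. \<forall>x\<in>P. poly_eval F x = 0}"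

definition lines_in_hypersurface :: "nat \<Rightarrow> nat cpoly \<Rightarrow> (nat \<Rightarrow> complex) set set set" where
  "lines_in_hypersurface n F = {L \<in> proj_lines n. L \<subseteq> hypersurface n F}"


section \<open>Generic hypersurfaces\<close>

text \<open>
  A property holds for the generic hypersurface of degree \<open>d\<close> if it holds on a nonempty Zariski open
  subset of the space of coefficient vectors. Every such set contains the nonvanishing locus of one
  nonzero polynomial \<open>D\<close>, whose variables are the coefficients of the form, that is, are indexed
  by the monomials of degree \<open>d\<close>.
\<close>

definition generic_hypersurface :: "nat \<Rightarrow> nat \<Rightarrow> (nat cpoly \<Rightarrow> bool) \<Rightarrow> bool" where
  "generic_hypersurface n d P \<longleftrightarrow>
     (\<exists>D :: (nat \<Rightarrow>\<^sub>0 nat) cpoly. D \<noteq> 0 \<and>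
        (\<forall>m\<in>Poly_Mapping.keys D. Poly_Mapping.keys m \<subseteq> monomials n d) \<and>
        (\<forall>F\<in>forms n d. F \<noteq> 0 \<and> poly_eval D (Poly_Mapping.lookup F) \<noteq> 0 \<longrightarrow> P F))"

text \<open>Finiteness is demanded separately because the cardinality of an infinite set is \<open>0\<close>.\<close>

definition is_generic_line_count :: "nat \<Rightarrow> nat \<Rightarrow> nat \<Rightarrow> bool" where
  "is_generic_line_count n d N \<longleftrightarrow>
     generic_hypersurface n d
       (\<lambda>F. finite (lines_in_hypersurface n F) \<and> card (lines_in_hypersurface n F) = N)"

end

theory Submission
  imports Defs "HOL-Library.Function_Algebras" "HOL-Library.FuncSet"
    "HOL-Computational_Algebra.Polynomial"
begin

text \<open>
  Cover the lines by fewer than $(n + 1)^2$ charts: those spanned by some $u$ with $u_i = 1$, $u_j = 0$ and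
  some $v$ with $v_i = 0$, $v_j = 1$. With $d = 2n - 3$, a chart has $N = 2n - 2 = d + 1$ coordinates, and a form \<open>F\<close> contains the line with chart
  coordinates \<open>x\<close> only if each of the \<open>N\<close> coefficients of \<open>F\<close> at a monomial in the variables \<open>i\<close>, \<open>j\<close>
  equals an expression of degree at most \<open>d\<close> in \<open>x\<close> and linear in the other coefficients.
  So the lines in a chart form a fibre of a polynomial map between spaces of dimension \<open>N\<close>.
  Comparing dimensions of spaces of polynomials gives a nonzero $P(F, T)$ of degree at
  most $(d + 1)^N$ in \<open>T\<close> that vanishes at $T = L(x)$ whenever \<open>F\<close> contains the line \<open>x\<close>, where \<open>L\<close> is a given
  linear form. For generic \<open>F\<close> the polynomial $P(F, \cdot)$ is nonzero, and some \<open>L\<close> from a finite family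
  fixed in advance separates the lines, so a chart contains at most $(2n - 2)^{2n - 2}$ of them.
  This replaces Bezout's theorem, and the factor $(n + 1)^2$ disappears in the error term.
\<close>

section \<open>Spaces of polynomials of bounded degree\<close>

text \<open>Vanishing outside \<open>X\<close> makes each exponent vector on \<open>X\<close> occur
  once, so that the set can be counted.\<close>

definition exponents_upto :: "'x set \<Rightarrow> nat \<Rightarrow> ('x \<Rightarrow> nat) set" where
  "exponents_upto X R = {h. (\<forall>i. i \<notin> X \<longrightarrow> h i = 0) \<and> sum h X \<le> R}"

text \<open>Splitting off the exponent \<open>r\<close> of the new variable leaves the budget
  \<open>R - r\<close> to the others; the induction below counts along this bijection.\<close>

lemma exponents_upto_insert:
  assumes "finite X" "k \<notin> X"
  shows "bij_betw (\<lambda>(r, h). h(k := r)) (SIGMA r:{..R}. exponents_upto X (R - r))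
           (exponents_upto (insert k X) R)"
proof (rule bij_betw_byWitness[where f' = "\<lambda>h. (h k, h(k := 0))"])
  have sum_upd: "(\<Sum>x\<in>X. if x = k then r else h x) = sum h X" for h :: "'a \<Rightarrow> nat" and r
    using assms by (intro sum.cong) auto
  show "\<forall>a\<in>SIGMA r:{..R}. exponents_upto X (R - r).
      (\<lambda>h. (h k, h(k := 0))) ((\<lambda>(r, h). h(k := r)) a) = a"
    using assms by (auto simp: exponents_upto_def)
  show "\<forall>a'\<in>exponents_upto (insert k X) R. (\<lambda>(r, h). h(k := r)) (a' k, a'(k := 0)) = a'"
    by auto
  show "(\<lambda>(r, h). h(k := r)) ` (SIGMA r:{..R}. exponents_upto X (R - r))
      \<subseteq> exponents_upto (insert k X) R"
    using assms by (auto simp: exponents_upto_def sum_upd)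
  show "(\<lambda>h. (h k, h(k := 0))) ` exponents_upto (insert k X) R
      \<subseteq> (SIGMA r:{..R}. exponents_upto X (R - r))"
    using assms by (auto simp: exponents_upto_def sum_upd)
qed

text \<open>Stars and bars: adding a variable sums binomial coefficients along a diagonal, which the
  hockey-stick identity evaluates.\<close>

lemma finite_card_exponents_upto:
  assumes "finite X"
  shows "finite (exponents_upto X R) \<and> card (exponents_upto X R) = (card X + R) choose card X"
  using assms
proof (induction X arbitrary: R rule: finite_induct)
  case empty
  have "exponents_upto {} R = {\<lambda>_ :: 'a. 0}"
    by (auto simp: exponents_upto_def)
  then show ?case by simp
next
  case (insert k X)
  note bij = exponents_upto_insert[OF insert.hyps, of R]
  have "card (exponents_upto (insert k X) R) =
      card (SIGMA r:{..R}. exponents_upto X (R - r))"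
    using bij_betw_same_card[OF bij] by simp
  also have "\<dots> = (\<Sum>r\<le>R. (card X + (R - r)) choose card X)"
    using insert.IH by simp
  also have "\<dots> = (\<Sum>r\<le>R. (card X + r) choose card X)"
    by (rule sum.reindex_bij_witness[where i = "\<lambda>r. R - r" and j = "\<lambda>r. R - r"]) auto
  also have "\<dots> = (card (insert k X) + R) choose card (insert k X)"
    using insert.hyps by (simp add: choose_rising_sum(1))
  finally show ?case
    using bij_betw_finite[OF bij] insert.IH by simp
qed

lemmas finite_exponents_upto = finite_card_exponents_upto[THEN conjunct1]
  and card_exponents_upto = finite_card_exponents_upto[THEN conjunct2]

text \<open>The right side is the product of the \<open>N\<close> factors from \<open>A + 1\<close>
  to \<open>A + N\<close>, each at least \<open>A\<close>.\<close>

lemma power_le_fact_mult_choose: "A ^ N \<le> fact N * ((N + A) choose N)"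
proof -
  have "A ^ N * fact A \<le> (fact (N + A) :: nat)"
  proof (induction N)
    case (Suc N)
    have "A ^ Suc N * fact A = A * (A ^ N * fact A)" by simp
    also have "\<dots> \<le> Suc (N + A) * fact (N + A)"
      by (intro mult_mono Suc) auto
    finally show ?case by simp
  qed simp
  also have "\<dots> = fact N * ((N + A) choose N) * fact A"
    using binomial_fact_lemma[of N "N + A"] by (simp add: ac_simps)
  finally show ?thesis by simp
qed

section \<open>Complex-valued functions as a vector space\<close>

interpretation fun_space: vector_space "\<lambda>(c::complex) (f::'a \<Rightarrow> complex) x. c * f x"
  by standard (auto simp: algebra_simps fun_eq_iff)

lemma fun_space_sum_apply: "(\<Sum>a\<in>A. f a) x = (\<Sum>a\<in>A. f a x)" for f :: "'b \<Rightarrow> 'a \<Rightarrow> complex"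
  by (induction A rule: infinite_finite_induct) auto

lemma fun_prod_apply: "(\<Prod>a\<in>A. f a) x = (\<Prod>a\<in>A. f a x)" for f :: "'b \<Rightarrow> 'a \<Rightarrow> complex"
  by (induction A rule: infinite_finite_induct) auto

lemma fun_power_apply: "(f ^ k) x = f x ^ k" for f :: "'a \<Rightarrow> complex"
  by (induction k) auto

text \<open>Multiplication is bilinear, so products of generators decide. Linearity is used first in
  the second factor, then in the first.\<close>

lemma fun_space_span_mult:
  assumes "f \<in> fun_space.span A" "g \<in> fun_space.span B"
    and "\<And>a b. a \<in> A \<Longrightarrow> b \<in> B \<Longrightarrow> a * b \<in> C"
  shows "f * g \<in> fun_space.span C"
proof -
  have "a * g \<in> fun_space.span C" if "a \<in> A" for a
    using assms(2)
  proof (induction rule: fun_space.span_induct_alt)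
    case base
    then show ?case by (simp only: mult_zero_right fun_space.span_zero)
  next
    case (step c b y)
    have "a * ((\<lambda>x. c * b x) + y) = (\<lambda>x. c * (a * b) x) + a * y"
      by (auto simp: fun_eq_iff algebra_simps)
    then show ?case
      using step assms(3)[OF that] by (metis fun_space.span_add fun_space.span_base fun_space.span_scale)
  qed
  note * = this
  show ?thesis
    using assms(1)
  proof (induction rule: fun_space.span_induct_alt)
    case base
    then show ?case by (simp only: mult_zero_left fun_space.span_zero)
  next
    case (step c a y)
    have "((\<lambda>x. c * a x) + y) * g = (\<lambda>x. c * (a * g) x) + y * g"
      by (auto simp: fun_eq_iff algebra_simps)
    then show ?case
      using step * by (metis fun_space.span_add fun_space.span_scale)
  qed
qed

text \<open>More vectors than a spanning set has are dependent. An indexed family is used because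
  different indices may give the same function; such a repetition yields a relation with
  coefficients 1 and -1.\<close>

lemma family_dependent_if_card_less:
  fixes f :: "'i \<Rightarrow> 'a \<Rightarrow> complex"
  assumes "finite U" "finite B" "card B < card U" "\<And>u. u \<in> U \<Longrightarrow> f u \<in> fun_space.span B"
  obtains c u0 where "u0 \<in> U" "c u0 \<noteq> 0" "\<And>x. (\<Sum>u\<in>U. c u * f u x) = 0"
proof (cases "inj_on f U")
  case True
  have "fun_space.dependent (f ` U)"
    using fun_space.independent_span_bound[OF assms(2), of "f ` U"] assms(3,4) card_image[OF True]
    by force
  then obtain c v where c: "v \<in> f ` U" "c v \<noteq> 0" "(\<Sum>v\<in>f ` U. (\<lambda>x. c v * v x)) = 0"
    using fun_space.dependent_finite[of "f ` U"] assms(1) by auto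
  have "(\<Sum>u\<in>U. c (f u) * f u x) = 0" for x
    using fun_cong[OF c(3), of x]
    by (simp only: fun_space_sum_apply sum.reindex[OF True] o_def zero_fun_apply)
  then show ?thesis
    using that[of _ "c \<circ> f"] c by auto
next
  case False
  then obtain u v where uv: "u \<in> U" "v \<in> U" "u \<noteq> v" "f u = f v"
    by (auto simp: inj_on_def)
  have "(\<Sum>w\<in>U. (if w = u then 1 else if w = v then - 1 else 0) * f w x) = 0" for x
  proof -
    have "(\<Sum>w\<in>U. (if w = u then 1 else if w = v then - 1 else 0) * f w x) =
        (\<Sum>w\<in>{u,v}. (if w = u then 1 else if w = v then - 1 else 0) * f w x)"
      using uv assms(1) by (intro sum.mono_neutral_right) auto
    then show ?thesis using uv by simp
  qed
  then show ?thesis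
    using that[of u "\<lambda>w. if w = u then 1 else if w = v then - 1 else 0"] uv by auto
qed

section \<open>Polynomials of bounded degree in the parameters \<open>F\<close> and the point
  \<open>x\<close>\<close>

definition monomial_fun ::
    "'w set \<Rightarrow> 'x set \<Rightarrow> ('w \<Rightarrow> nat) \<Rightarrow> ('x \<Rightarrow> nat) \<Rightarrow> ('w \<Rightarrow> complex) \<times> ('x \<Rightarrow> complex) \<Rightarrow> complex"
  where "monomial_fun Q X g h = (\<lambda>(F, x). (\<Prod>m\<in>Q. F m ^ g m) * (\<Prod>i\<in>X. x i ^ h i))"

text \<open>The two bounds differ in kind on purpose. A bound for each parameter separately gives
  \<open>(S + 1) ^ card Q\<close> choices, a number that changes only by a factor close to 1 when a
  large \<open>S\<close> is raised by a constant. The total degree in \<open>x\<close> gives the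
  sharp binomial count.\<close>

definition bounded_monomials ::
    "'w set \<Rightarrow> 'x set \<Rightarrow> nat \<Rightarrow> nat \<Rightarrow> (('w \<Rightarrow> complex) \<times> ('x \<Rightarrow> complex) \<Rightarrow> complex) set" where
  "bounded_monomials Q X S R = {monomial_fun Q X g h | g h. (\<forall>m\<in>Q. g m \<le> S) \<and> sum h X \<le> R}"

abbreviation bounded_polys ::
    "'w set \<Rightarrow> 'x set \<Rightarrow> nat \<Rightarrow> nat \<Rightarrow> (('w \<Rightarrow> complex) \<times> ('x \<Rightarrow> complex) \<Rightarrow> complex) set" where
  "bounded_polys Q X S R \<equiv> fun_space.span (bounded_monomials Q X S R)"

lemma bounded_monomials_subset:
  assumes "finite Q" "finite X"
  shows "bounded_monomials Q X S R \<subseteq>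
    (\<lambda>(g, h). monomial_fun Q X g h) ` ((Q \<rightarrow>\<^sub>E {..S}) \<times> exponents_upto X R)"
proof
  fix f assume "f \<in> bounded_monomials Q X S R"
  then obtain g h where gh: "\<forall>m\<in>Q. g m \<le> S" "sum h X \<le> R" "f = monomial_fun Q X g h"
    by (auto simp: bounded_monomials_def)
  define h' where "h' i = (if i \<in> X then h i else 0)" for i
  have "f = monomial_fun Q X (restrict g Q) h'"
    unfolding gh monomial_fun_def h'_def
    by (auto simp: fun_eq_iff intro!: arg_cong2[where f="(*)"] prod.cong)
  moreover have "sum h' X = sum h X" by (simp add: h'_def)
  then have "h' \<in> exponents_upto X R" using gh by (simp add: exponents_upto_def) (simp add: h'_def)
  ultimately show "f \<in> (\<lambda>(g, h). monomial_fun Q X g h) ` ((Q \<rightarrow>\<^sub>E {..S}) \<times> exponents_upto X R)"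
    using gh by (intro image_eqI[of _ _ "(restrict g Q, h')"]) auto
qed

lemma finite_bounded_monomials:
  assumes "finite Q" "finite X"
  shows "finite (bounded_monomials Q X S R)"
  by (rule finite_subset[OF bounded_monomials_subset[OF assms]])
    (use assms in \<open>auto intro!: finite_PiE finite_exponents_upto\<close>)

lemma card_bounded_monomials:
  assumes "finite Q" "finite X"
  shows "card (bounded_monomials Q X S R) \<le> (S + 1) ^ card Q * ((card X + R) choose card X)"
proof -
  let ?A = "(Q \<rightarrow>\<^sub>E {..S}) \<times> exponents_upto X R"
  have "finite ?A" using assms by (auto intro!: finite_PiE finite_exponents_upto)
  then have "card (bounded_monomials Q X S R) \<le> card ?A"
    using bounded_monomials_subset[OF assms] surj_card_le by metis
  also have "\<dots> = (S + 1) ^ card Q * ((card X + R) choose card X)"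
    using assms by (simp add: card_cartesian_product card_PiE card_exponents_upto)
  finally show ?thesis .
qed

lemma bounded_polys_mono:
  assumes "f \<in> bounded_polys Q X S R" "S \<le> S'" "R \<le> R'"
  shows "f \<in> bounded_polys Q X S' R'"
proof -
  have "bounded_monomials Q X S R \<subseteq> bounded_monomials Q X S' R'"
    unfolding bounded_monomials_def using assms(2,3) le_trans by blast
  then show ?thesis using assms(1) fun_space.span_mono by blast
qed

lemma bounded_polys_mult:
  assumes "f \<in> bounded_polys Q X S R" "g \<in> bounded_polys Q X S' R'"
  shows "f * g \<in> bounded_polys Q X (S + S') (R + R')"
proof (rule fun_space_span_mult[OF assms])
  fix a b :: "('a \<Rightarrow> complex) \<times> ('b \<Rightarrow> complex) \<Rightarrow> complex"
  assume "a \<in> bounded_monomials Q X S R" "b \<in> bounded_monomials Q X S' R'"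
  then obtain g h g' h' where gh: "\<forall>m\<in>Q. g m \<le> S" "sum h X \<le> R" "a = monomial_fun Q X g h"
     "\<forall>m\<in>Q. g' m \<le> S'" "sum h' X \<le> R'" "b = monomial_fun Q X g' h'"
    by (auto simp: bounded_monomials_def)
  have "a * b = monomial_fun Q X (\<lambda>m. g m + g' m) (\<lambda>i. h i + h' i)"
    by (auto simp: gh monomial_fun_def fun_eq_iff power_add prod.distrib)
  then show "a * b \<in> bounded_monomials Q X (S + S') (R + R')"
    using gh unfolding bounded_monomials_def
    by (intro CollectI exI[of _ "\<lambda>m. g m + g' m"] exI[of _ "\<lambda>i. h i + h' i"])
      (auto simp: sum.distrib add_mono)
qed

lemma bounded_polys_one: "1 \<in> bounded_polys Q X S R"
  unfolding bounded_monomials_def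
  by (intro fun_space.span_base CollectI exI[of _ "\<lambda>_. 0"]) (auto simp: monomial_fun_def fun_eq_iff)

lemma bounded_polys_const: "(\<lambda>_. c) \<in> bounded_polys Q X S R"
  using fun_space.span_scale[OF bounded_polys_one, of c] by simp

lemma bounded_polys_power:
  assumes "f \<in> bounded_polys Q X S R"
  shows "f ^ k \<in> bounded_polys Q X (k * S) (k * R)"
proof (induction k)
  case 0
  show ?case by (simp only: power_0 mult_0 bounded_polys_one)
next
  case (Suc k)
  show ?case using bounded_polys_mult[OF assms Suc] by (simp only: power_Suc mult_Suc)
qed

lemma bounded_polys_prod:
  assumes "\<And>a. a \<in> I \<Longrightarrow> f a \<in> bounded_polys Q X (S a) (R a)"
  shows "(\<Prod>a\<in>I. f a) \<in> bounded_polys Q X (\<Sum>a\<in>I. S a) (\<Sum>a\<in>I. R a)"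
  using assms
proof (induction I rule: infinite_finite_induct)
  case (insert a I)
  have "f a * prod f I \<in> bounded_polys Q X (S a + sum S I) (R a + sum R I)"
    by (intro bounded_polys_mult insert) auto
  then show ?case by (simp only: prod.insert[OF insert.hyps] sum.insert[OF insert.hyps])
qed (simp_all only: bounded_polys_one prod.empty prod.infinite sum.empty sum.infinite not_False_eq_True)

lemma bounded_polys_param:
  assumes "finite Q" "m \<in> Q"
  shows "(\<lambda>(F, x). F m) \<in> bounded_polys Q X 1 0"
proof -
  have "(\<Prod>k\<in>Q. F k ^ (if k = m then 1 else 0)) = F m" for F :: "'a \<Rightarrow> complex"
    using prod.delta[OF assms(1), of m F] assms(2) by (simp add: if_distrib cong: if_cong)
  then have "(\<lambda>(F, x). F m) = monomial_fun Q X (\<lambda>k. if k = m then 1 else 0) (\<lambda>_. 0)"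
    by (auto simp: monomial_fun_def fun_eq_iff)
  then show ?thesis
    unfolding bounded_monomials_def by (intro fun_space.span_base CollectI) force
qed

lemma bounded_polys_var:
  assumes "finite X" "i \<in> X"
  shows "(\<lambda>(F, x). x i) \<in> bounded_polys Q X 0 1"
proof -
  have "(\<Prod>k\<in>X. x k ^ (if k = i then 1 else 0)) = x i" for x :: "'a \<Rightarrow> complex"
    using prod.delta[OF assms(1), of i x] assms(2) by (simp add: if_distrib cong: if_cong)
  then have *: "(\<lambda>(F, x). x i) = monomial_fun Q X (\<lambda>_. 0) (\<lambda>k. if k = i then 1 else 0)"
    by (auto simp: monomial_fun_def fun_eq_iff)
  show ?thesis
    unfolding bounded_monomials_def
    by (intro fun_space.span_base CollectI exI[of _ "\<lambda>_. 0"] exI[of _ "\<lambda>k. if k = i then 1 else 0"] conjI *)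
      (use assms in auto)
qed

section \<open>Elimination and generic fibres\<close>

text \<open>A polynomial with a nonzero coefficient does not vanish identically: viewed as a
  polynomial in one variable, it has a coefficient that is nonzero by induction at some choice of
  the others. The injective labelling \<open>e\<close> lets the lemma serve both eliminants and the
  polynomial \<open>D\<close>.\<close>

lemma ex_nonvanishing_monomial_sum:
  fixes c :: "'a \<Rightarrow> complex" and e :: "'a \<Rightarrow> 'i \<Rightarrow> nat"
  assumes "finite I" "finite M" "\<And>a b. a \<in> M \<Longrightarrow> b \<in> M \<Longrightarrow> (\<And>i. i \<in> I \<Longrightarrow> e a i = e b i) \<Longrightarrow> a = b"
    and "a0 \<in> M" "c a0 \<noteq> 0"
  shows "\<exists>x. (\<Sum>a\<in>M. c a * (\<Prod>i\<in>I. x i ^ e a i)) \<noteq> 0"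
  using assms
proof (induction I arbitrary: M rule: finite_induct)
  case empty
  then have "M = {a0}" by blast
  then show ?case using empty by simp
next
  case (insert k I)
  \<comment> \<open>These terms form the coefficient of the power \<open>e a0 k\<close> of variable
    \<open>k\<close>.\<close>
  define M' where "M' = {a \<in> M. e a k = e a0 k}"
  have "\<exists>x. (\<Sum>a\<in>M'. c a * (\<Prod>i\<in>I. x i ^ e a i)) \<noteq> 0"
  proof (rule insert.IH)
    show "a = b" if "a \<in> M'" "b \<in> M'" "\<And>i. i \<in> I \<Longrightarrow> e a i = e b i" for a b
      using that by (intro insert.prems(2)) (auto simp: M'_def)
  qed (use insert.prems in \<open>auto simp: M'_def\<close>)
  then obtain x where x: "(\<Sum>a\<in>M'. c a * (\<Prod>i\<in>I. x i ^ e a i)) \<noteq> 0" ..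
  define q where "q = (\<Sum>a\<in>M. monom (c a * (\<Prod>i\<in>I. x i ^ e a i)) (e a k))"
  have "coeff q (e a0 k) = (\<Sum>a\<in>M. if e a k = e a0 k then c a * (\<Prod>i\<in>I. x i ^ e a i) else 0)"
    by (simp add: q_def coeff_sum)
  also have "\<dots> = (\<Sum>a\<in>M'. c a * (\<Prod>i\<in>I. x i ^ e a i))"
    using insert.prems(1) by (simp add: M'_def sum.inter_filter)
  finally have "q \<noteq> 0" using x by auto
  then obtain t where t: "poly q t \<noteq> 0"
    using poly_all_0_iff_0 by blast
  have "(\<Sum>a\<in>M. c a * (\<Prod>i\<in>insert k I. (x(k := t)) i ^ e a i)) = poly q t"
  proof -
    have "(\<Prod>i\<in>I. (x(k := t)) i ^ e a i) = (\<Prod>i\<in>I. x i ^ e a i)" for a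
      using insert.hyps by (intro prod.cong) auto
    then show ?thesis
      unfolding q_def poly_sum poly_monom using insert.hyps
      by (intro sum.cong) (simp_all add: prod.insert del: fun_upd_apply, simp)
  qed
  then show ?case using t by (intro exI[of _ "x(k := t)"]) simp
qed

text \<open>
  Polynomial dependence on the coefficients is used only through its restriction to lines, which
  suffices for a product of nonzero functions to be nonzero.
\<close>

definition line_poly :: "(('i \<Rightarrow> complex) \<Rightarrow> complex) \<Rightarrow> bool" where
  "line_poly f \<longleftrightarrow> (\<forall>u v. \<exists>p. \<forall>t. f (\<lambda>i. u i + t * v i) = poly p t)"

lemma line_poly_const: "line_poly (\<lambda>_. c)"
  unfolding line_poly_def by (intro allI exI[of _ "[:c:]"]) simp

lemma line_poly_coord: "line_poly (\<lambda>F. F i)"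
  unfolding line_poly_def
proof (intro allI)
  fix u v :: "'a \<Rightarrow> complex"
  show "\<exists>p. \<forall>t. u i + t * v i = poly p t"
    by (intro exI[of _ "[:u i, v i:]"]) simp
qed

lemma line_poly_add:
  assumes "line_poly f" "line_poly g"
  shows "line_poly (\<lambda>F. f F + g F)"
  using assms unfolding line_poly_def by (metis poly_add)

lemma line_poly_mult:
  assumes "line_poly f" "line_poly g"
  shows "line_poly (\<lambda>F. f F * g F)"
  using assms unfolding line_poly_def by (metis poly_mult)

lemma line_poly_sum:
  assumes "\<And>a. a \<in> I \<Longrightarrow> line_poly (f a)"
  shows "line_poly (\<lambda>F. \<Sum>a\<in>I. f a F)"
  using assms
  by (induction I rule: infinite_finite_induct) (auto intro: line_poly_add line_poly_const)

lemma line_poly_prod: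
  assumes "\<And>a. a \<in> I \<Longrightarrow> line_poly (f a)"
  shows "line_poly (\<lambda>F. \<Prod>a\<in>I. f a F)"
  using assms
  by (induction I rule: infinite_finite_induct) (auto intro: line_poly_mult line_poly_const)

lemma line_poly_power:
  assumes "line_poly f"
  shows "line_poly (\<lambda>F. f F ^ k)"
  by (induction k) (auto intro: line_poly_mult line_poly_const assms)

text \<open>On the line joining a point good for the old functions to a point good for the new one,
  every function restricts to a nonzero polynomial in \<open>t\<close>. The product of these
  polynomials has a point where it does not vanish.\<close>

lemma ex_common_nonvanishing:
  assumes "finite I" "\<And>a. a \<in> I \<Longrightarrow> line_poly (f a)" "\<And>a. a \<in> I \<Longrightarrow> \<exists>F. f a F \<noteq> 0"
  shows "\<exists>F. \<forall>a\<in>I. f a F \<noteq> 0"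
  using assms
proof (induction I rule: finite_induct)
  case (insert b I)
  obtain u where u: "\<forall>a\<in>I. f a u \<noteq> 0" using insert by auto
  obtain w where w: "f b w \<noteq> 0" using insert.prems(2) by blast
  define P where "P t = (\<lambda>i. u i + t * (w i - u i))" for t :: complex
  have "\<exists>p. \<forall>t. f a (P t) = poly p t" if "a \<in> insert b I" for a
    using insert.prems(1)[OF that, unfolded line_poly_def, rule_format, of u "\<lambda>i. w i - u i"]
    unfolding P_def .
  then obtain p where p: "\<And>a t. a \<in> insert b I \<Longrightarrow> f a (P t) = poly (p a) t"
    by metis
  have "p a \<noteq> 0" if "a \<in> insert b I" for a
  proof (cases "a = b")
    case True
    have "P 1 = w" by (simp add: P_def)
    then have "poly (p a) 1 \<noteq> 0" using p[of b 1] w True by simp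
    then show ?thesis by auto
  next
    case False
    have "P 0 = u" by (simp add: P_def)
    then have "poly (p a) 0 \<noteq> 0" using p[OF that, of 0] u that False by auto
    then show ?thesis by auto
  qed
  then have "(\<Prod>a\<in>insert b I. p a) \<noteq> 0" using insert.hyps by auto
  then obtain t where "poly (\<Prod>a\<in>insert b I. p a) t \<noteq> 0"
    using poly_all_0_iff_0 by blast
  then have "\<forall>a\<in>insert b I. poly (p a) t \<noteq> 0" using insert.hyps
    by (auto simp: poly_prod)
  then show ?case using p by metis
qed simp

text \<open>The quotient of the two powers tends to 1 as \<open>S\<close> grows, so it cannot undo
  the strict inequality \<open>E < U\<close>.\<close>

lemma ex_growth_parameter:
  fixes E U :: nat
  assumes "E < U"
  shows "\<exists>S. (S + A + 1) ^ K * E < (S + 1) ^ K * U"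
proof -
  have "(\<lambda>S. (1 + real A * inverse (real (Suc S))) ^ K * real E) \<longlonglongrightarrow> (1 + real A * 0) ^ K * real E"
    by (intro tendsto_intros LIMSEQ_inverse_real_of_nat)
  then have "\<forall>\<^sub>F S in sequentially. (1 + real A * inverse (real (Suc S))) ^ K * real E < real U"
    using assms by (intro order_tendstoD(2)[where y = "real E"]) auto
  then obtain S where S: "(1 + real A * inverse (real (Suc S))) ^ K * real E < real U"
    by (auto simp: eventually_sequentially)
  have "1 + real A * inverse (real (Suc S)) = real (S + A + 1) / real (S + 1)"
    by (simp add: field_simps)
  then have "real (S + A + 1) ^ K / real (S + 1) ^ K * real E < real U"
    using S by (simp only: power_divide)
  then have "real (S + A + 1) ^ K * real E < real (S + 1) ^ K * real U"
    by (simp add: field_simps)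
  then have "real ((S + A + 1) ^ K * E) < real ((S + 1) ^ K * U)"
    by simp
  then show ?thesis by (intro exI[of _ S]) (simp only: of_nat_less_iff)
qed

text \<open>The choice of \<open>A\<close> makes \<open>N + (d * A + J)\<close> equal to
  \<open>(d + 1) * A\<close>. Up to the factor \<open>fact N\<close>, the left side is then at most
  \<open>J * A ^ N\<close>, so the \<open>J + 1\<close> powers of \<open>L\<close> just
  suffice.\<close>

lemma monomial_count:
  fixes d N :: nat
  defines "J \<equiv> (d + 1) ^ N" and "A \<equiv> (d + 1) ^ N + N"
  shows "(N + (d * A + J)) choose N < ((N + A) choose N) * (J + 1)"
proof -
  have "fact N * ((N + (d * A + J)) choose N) \<le> (N + (d * A + J)) ^ N"
    using binomial_fact_pow[of "N + (d * A + J)" N] by (simp add: mult.commute)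
  also have "(N + (d * A + J)) ^ N = ((d + 1) * A) ^ N" by (simp add: A_def J_def algebra_simps)
  also have "\<dots> = J * A ^ N" by (simp only: J_def power_mult_distrib)
  also have "\<dots> \<le> J * (fact N * ((N + A) choose N))"
    by (intro mult_le_mono2 power_le_fact_mult_choose)
  also have "\<dots> = fact N * (J * ((N + A) choose N))" by simp
  finally have "(N + (d * A + J)) choose N \<le> J * ((N + A) choose N)"
    by (simp only: mult_le_cancel1 fact_gt_zero)
  also have "\<dots> < ((N + A) choose N) * (J + 1)" by simp
  finally show ?thesis .
qed

text \<open>
  \<open>Q\<close> indexes the free coefficients, \<open>W\<close> those that a point \<open>x\<close> of the fibre determines. The products
  \<open>F\<^sup>g \<phi>\<^sup>h L\<^sup>j\<close> outnumber the monomials they are combined from, since the bound \<open>S\<close> on the exponents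
  \<open>g\<close> is taken so large that raising it by \<open>A\<close> hardly changes the number of choices.
\<close>

lemma elimination:
  fixes \<phi> :: "'w \<Rightarrow> ('w \<Rightarrow> complex) \<times> ('x \<Rightarrow> complex) \<Rightarrow> complex" and L :: "('x \<Rightarrow> complex) \<Rightarrow> complex"
  assumes fin: "finite Q" "finite W" "finite X" and disj: "Q \<inter> W = {}"
    and cardW: "card W = N" and cardX: "card X = N"
    and phi: "\<And>w. w \<in> W \<Longrightarrow> \<phi> w \<in> bounded_polys Q X 1 d"
    and L: "(\<lambda>(F, x). L x) \<in> bounded_polys Q X 0 1"
  defines "J \<equiv> (d + 1) ^ N"
  shows "\<exists>a. (\<forall>j. line_poly (a j)) \<and> (\<exists>j\<le>J. \<exists>F. a j F \<noteq> 0) \<and>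
    (\<forall>F x. (\<forall>w\<in>W. F w = \<phi> w (F, x)) \<longrightarrow> (\<Sum>j\<le>J. a j F * L x ^ j) = 0)"
proof -
  define A where "A = (d + 1) ^ N + N"
  define R where "R = d * A + J"
  obtain S where S: "(S + A + 1) ^ card Q * ((N + R) choose N) <
      (S + 1) ^ card Q * (((N + A) choose N) * (J + 1))"
    using ex_growth_parameter[OF monomial_count[of N d], of A "card Q"]
    unfolding R_def A_def J_def by auto
  define G where "G = (Q \<rightarrow>\<^sub>E {..S}) \<times> exponents_upto W A"
  have finG: "finite G"
    using fin by (auto simp: G_def intro!: finite_PiE finite_exponents_upto)
  define f where "f = (\<lambda>((g, h), j). monomial_fun Q X g (\<lambda>_. 0) * (\<Prod>w\<in>W. \<phi> w ^ h w) *
      (\<lambda>(F, x). L x) ^ j)"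
  \<comment> \<open>In each parameter, \<open>g\<close> contributes at most \<open>S\<close> and the
    powers of the \<open>\<phi> w\<close> at most \<open>A\<close>. In \<open>x\<close>, the latter
    contribute at most \<open>d * A\<close> and the power of \<open>L\<close> at most
    \<open>J\<close>.\<close>
  have f_bounded: "f u \<in> bounded_polys Q X (S + A) R" if u: "u \<in> G \<times> {..J}" for u
  proof -
    obtain g h j where ghj: "u = ((g, h), j)" "g \<in> Q \<rightarrow>\<^sub>E {..S}" "sum h W \<le> A" "j \<le> J"
      using u by (auto simp: G_def exponents_upto_def)
    have g: "monomial_fun Q X g (\<lambda>_. 0) \<in> bounded_polys Q X S 0"
      using ghj unfolding bounded_monomials_def
      by (intro fun_space.span_base CollectI exI[of _ g] exI[of _ "\<lambda>_. 0"]) auto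
    have "(\<Prod>w\<in>W. \<phi> w ^ h w) \<in> bounded_polys Q X (\<Sum>w\<in>W. h w * 1) (\<Sum>w\<in>W. h w * d)"
      by (intro bounded_polys_prod bounded_polys_power phi)
    then have h: "(\<Prod>w\<in>W. \<phi> w ^ h w) \<in> bounded_polys Q X A (d * A)"
      by (rule bounded_polys_mono) (use ghj(3) in \<open>simp_all add: sum_distrib_right[symmetric]\<close>)
    have "(\<lambda>(F, x). L x) ^ j \<in> bounded_polys Q X (j * 0) (j * 1)"
      by (intro bounded_polys_power L)
    then have j: "(\<lambda>(F, x). L x) ^ j \<in> bounded_polys Q X 0 J"
      by (rule bounded_polys_mono) (use ghj in auto)
    show ?thesis
      unfolding f_def ghj(1) prod.case
      by (rule bounded_polys_mono[OF bounded_polys_mult[OF bounded_polys_mult[OF g h] j]])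
        (auto simp: R_def)
  qed
  have card_less: "card (bounded_monomials Q X (S + A) R) < card (G \<times> {..J})"
  proof -
    have "card (bounded_monomials Q X (S + A) R) \<le> (S + A + 1) ^ card Q * ((N + R) choose N)"
      using card_bounded_monomials[OF fin(1,3), of "S + A" R] cardX by simp
    also note S
    also have "(S + 1) ^ card Q * (((N + A) choose N) * (J + 1)) = card (G \<times> {..J})"
      using fin cardW
      by (simp add: G_def card_cartesian_product card_PiE card_exponents_upto algebra_simps)
    finally show ?thesis .
  qed
  obtain c u0 where cu: "u0 \<in> G \<times> {..J}" "c u0 \<noteq> 0"
      "\<And>z. (\<Sum>u\<in>G \<times> {..J}. c u * f u z) = 0"
    by (rule family_dependent_if_card_less[OF _ finite_bounded_monomials[OF fin(1,3)] card_less f_bounded])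
      (use finG in auto)
  \<comment> \<open>On the fibre \<open>\<phi> w\<close> takes the value \<open>F w\<close>, so the
    pair \<open>(g, h)\<close> becomes a single exponent vector on
    \<open>Q \<union> W\<close>.\<close>
  define e where "e = (\<lambda>(g, h) m. if m \<in> Q then g m else h m :: nat)"
  define a where "a j F = (\<Sum>b\<in>G. c (b, j) * (\<Prod>m\<in>Q \<union> W. F m ^ e b m))" for j and F :: "'w \<Rightarrow> complex"
  obtain b0 j0 where b0: "u0 = (b0, j0)" "b0 \<in> G" "j0 \<le> J" using cu(1) by auto
  \<comment> \<open>Distinct pairs give distinct monomials in \<open>F\<close>, so collecting the
    terms with a fixed power of \<open>L\<close> cannot cancel the nonzero coefficient at
    \<open>u0\<close>.\<close>
  have e_inj: "b = b'" if "b \<in> G" "b' \<in> G" and eq: "\<And>m. m \<in> Q \<union> W \<Longrightarrow> e b m = e b' m" for b b'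
  proof -
    obtain g h g' h' where gh: "b = (g, h)" "b' = (g', h')" by (cases b, cases b')
    have "g m = g' m" if "m \<in> Q" for m
      using eq[of m] that by (simp add: e_def gh)
    moreover have "h m = h' m" for m
      using eq[of m] \<open>b \<in> G\<close> \<open>b' \<in> G\<close> disj
      by (cases "m \<in> W") (auto simp: e_def gh G_def exponents_upto_def)
    ultimately show ?thesis
      using \<open>b \<in> G\<close> \<open>b' \<in> G\<close> by (auto simp: gh G_def intro: PiE_ext)
  qed
  have "\<exists>F. a j0 F \<noteq> 0"
    unfolding a_def
    by (rule ex_nonvanishing_monomial_sum[OF _ finG e_inj b0(2)]) (use fin cu b0 in auto)
  moreover have "line_poly (a j)" for j
    unfolding a_def
    by (intro line_poly_sum line_poly_mult line_poly_prod line_poly_power line_poly_const line_poly_coord)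
  moreover have "(\<Sum>j\<le>J. a j F * L x ^ j) = 0" if F: "\<forall>w\<in>W. F w = \<phi> w (F, x)" for F x
  proof -
    \<comment> \<open>The relation holds for all \<open>F\<close> and \<open>x\<close>; the fibre
      condition enters only in this substitution.\<close>
    have f_eq: "f (b, j) (F, x) = (\<Prod>m\<in>Q \<union> W. F m ^ e b m) * L x ^ j" for b j
    proof -
      obtain g h where gh: "b = (g, h)" by (cases b)
      have "(\<Prod>m\<in>W. F m ^ e b m) = (\<Prod>w\<in>W. \<phi> w (F, x) ^ h w)"
        using disj F by (intro prod.cong) (auto simp: e_def gh)
      then show ?thesis
        using fin disj
        by (simp add: f_def gh monomial_fun_def fun_prod_apply fun_power_apply prod.union_disjoint)
          (simp add: e_def)
    qed
    have "(\<Sum>j\<le>J. a j F * L x ^ j) = (\<Sum>j\<le>J. \<Sum>b\<in>G. c (b, j) * f (b, j) (F, x))"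
      by (simp add: a_def f_eq sum_distrib_right mult.assoc)
    also have "\<dots> = (\<Sum>u\<in>G \<times> {..J}. c u * f u (F, x))"
      by (subst sum.swap) (simp add: sum.cartesian_product case_prod_unfold)
    finally show ?thesis using cu(3) by simp
  qed
  ultimately show ?thesis using b0(3) by (intro exI[of _ a]) blast
qed

text \<open>The values of \<open>L\<close> on the fibre are roots of the polynomial with
  coefficients \<open>a j F\<close>, which is nonzero as soon as \<open>a j0 F\<close> is. Even for
  infinite \<open>Z\<close> the image is therefore finite.\<close>

lemma generic_fibre_card_image:
  fixes \<phi> :: "'w \<Rightarrow> ('w \<Rightarrow> complex) \<times> ('x \<Rightarrow> complex) \<Rightarrow> complex" and L :: "('x \<Rightarrow> complex) \<Rightarrow> complex"
  assumes "finite Q" "finite W" "finite X" "Q \<inter> W = {}" "card W = N" "card X = N"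
    and "\<And>w. w \<in> W \<Longrightarrow> \<phi> w \<in> bounded_polys Q X 1 d"
    and "(\<lambda>(F, x). L x) \<in> bounded_polys Q X 0 1"
  shows "\<exists>p. line_poly p \<and> (\<exists>F. p F \<noteq> 0) \<and>
    (\<forall>F Z. p F \<noteq> 0 \<longrightarrow> (\<forall>x\<in>Z. \<forall>w\<in>W. F w = \<phi> w (F, x)) \<longrightarrow> card (L ` Z) \<le> (d + 1) ^ N)"
proof -
  define J where "J = (d + 1) ^ N"
  obtain a j0 F0 where a: "\<And>j. line_poly (a j)" "j0 \<le> J" "a j0 F0 \<noteq> 0"
    "\<And>F x. (\<forall>w\<in>W. F w = \<phi> w (F, x)) \<Longrightarrow> (\<Sum>j\<le>J. a j F * L x ^ j) = 0"
    using elimination[of Q W X N \<phi> d L, OF assms] unfolding J_def by blast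
  have "card (L ` Z) \<le> J" if F: "a j0 F \<noteq> 0" "\<forall>x\<in>Z. \<forall>w\<in>W. F w = \<phi> w (F, x)" for F Z
  proof -
    define P where "P = (\<Sum>j\<le>J. monom (a j F) j)"
    have "coeff P j0 = a j0 F"
      using a(2) by (simp add: P_def coeff_sum)
    then have "P \<noteq> 0" using F by auto
    have "degree P \<le> J" unfolding P_def
      by (intro degree_sum_le) (auto intro: order_trans[OF degree_monom_le])
    have "L ` Z \<subseteq> {t. poly P t = 0}"
      using F a(4) by (auto simp: P_def poly_sum poly_monom)
    then have "card (L ` Z) \<le> card {t. poly P t = 0}"
      by (intro card_mono poly_roots_finite \<open>P \<noteq> 0\<close>)
    also have "\<dots> \<le> degree P" by (intro card_poly_roots_bound \<open>P \<noteq> 0\<close>)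
    finally show ?thesis using \<open>degree P \<le> J\<close> by simp
  qed
  then show ?thesis
    using a unfolding J_def by (intro exI[of _ "a j0"]) blast
qed

text \<open>Two points agree under at most \<open>N\<close> of these forms, as \<open>q\<close> is a root of a polynomial of degree below \<open>N\<close>.\<close>

definition power_form :: "('x \<Rightarrow> nat) \<Rightarrow> 'x set \<Rightarrow> nat \<Rightarrow> ('x \<Rightarrow> complex) \<Rightarrow> complex" where
  "power_form \<iota> X q x = (\<Sum>i\<in>X. of_nat q ^ \<iota> i * x i)"

lemma power_form_bounded_polys:
  assumes "finite X"
  shows "(\<lambda>(F, x). power_form \<iota> X q x) \<in> bounded_polys Q X 0 1"
proof -
  have "(\<lambda>(F, x). power_form \<iota> X q x) = (\<Sum>i\<in>X. (\<lambda>_. of_nat q ^ \<iota> i) * (\<lambda>(F, x). x i))"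
    by (auto simp: fun_eq_iff power_form_def fun_space_sum_apply)
  also have "\<dots> \<in> bounded_polys Q X (0 + 0) (0 + 1)"
    by (intro fun_space.span_sum bounded_polys_mult bounded_polys_const bounded_polys_var assms)
  finally show ?thesis by simp
qed

lemma card_power_form_coincidences:
  assumes "finite X" "inj_on \<iota> X" "\<iota> ` X \<subseteq> {..<N}" "i \<in> X" "x i \<noteq> y i"
  shows "finite {q. power_form \<iota> X q x = power_form \<iota> X q y} \<and>
    card {q. power_form \<iota> X q x = power_form \<iota> X q y} \<le> N"
proof -
  define P where "P = (\<Sum>k\<in>X. monom (x k - y k) (\<iota> k))"
  \<comment> \<open>Injectivity of \<open>\<iota>\<close> keeps the differing coordinate
    \<open>i\<close> from being cancelled by another one.\<close>
  have "coeff P (\<iota> i) = (\<Sum>k\<in>X. if k = i then x k - y k else 0)"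
    unfolding P_def coeff_sum using assms(2,4) by (intro sum.cong) (auto simp: inj_on_def)
  then have "P \<noteq> 0" using assms by auto
  have "degree P \<le> N" unfolding P_def using assms(3)
    by (intro degree_sum_le assms(1)) (auto intro!: order_trans[OF degree_monom_le])
  let ?B = "{q. power_form \<iota> X q x = power_form \<iota> X q y}"
  have "poly P (of_nat q) = power_form \<iota> X q x - power_form \<iota> X q y" for q
    by (simp add: P_def poly_sum poly_monom power_form_def sum_subtractf[symmetric] algebra_simps)
  then have sub: "of_nat ` ?B \<subseteq> {t. poly P t = 0}" by auto
  note fin = poly_roots_finite[OF \<open>P \<noteq> 0\<close>]
  have inj: "inj_on (of_nat :: nat \<Rightarrow> complex) ?B" by (simp add: inj_on_def)
  have "finite ?B" using finite_imageD[OF finite_subset[OF sub fin] inj] .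
  moreover have "card ?B \<le> N"
    using card_mono[OF fin sub] card_image[OF inj] card_poly_roots_bound[OF \<open>P \<noteq> 0\<close>] \<open>degree P \<le> N\<close>
    by linarith
  ultimately show ?thesis by blast
qed

text \<open>At most \<open>M * M\<close> pairs of distinct points each exclude at most
  \<open>N\<close> values of \<open>q\<close>, so one of the \<open>M * M * N + 1\<close> candidates
  survives. The range of \<open>q\<close> depends on \<open>Z\<close> only through the bound
  \<open>M\<close>.\<close>

lemma ex_separating_power_form:
  assumes "finite X" "inj_on \<iota> X" "\<iota> ` X \<subseteq> {..<N}" "finite Z" "card Z \<le> M"
    and "\<And>x i. x \<in> Z \<Longrightarrow> i \<notin> X \<Longrightarrow> x i = 0"
  shows "\<exists>q\<le>M * M * N. inj_on (power_form \<iota> X q) Z"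
proof -
  define B where "B = (\<lambda>(x, y). {q. power_form \<iota> X q x = power_form \<iota> X q y})"
  define D where "D = {(x, y) \<in> Z \<times> Z. x \<noteq> y}"
  have finD: "finite D" using assms(4) by (auto simp: D_def intro: finite_subset[of _ "Z \<times> Z"])
  have B: "finite (B xy) \<and> card (B xy) \<le> N" if "xy \<in> D" for xy
  proof -
    obtain x y where xy: "xy = (x, y)" "x \<in> Z" "y \<in> Z" "x \<noteq> y"
      using \<open>xy \<in> D\<close> unfolding D_def by blast
    then obtain i where "x i \<noteq> y i" by (auto simp: fun_eq_iff)
    moreover have "i \<in> X" using assms(6)[of x i] assms(6)[of y i] xy calculation by auto
    ultimately show ?thesis
      unfolding B_def xy using card_power_form_coincidences[OF assms(1-3)] by simp
  qed
  have "card (\<Union>xy\<in>D. B xy) \<le> (\<Sum>xy\<in>D. card (B xy))" by (rule card_UN_le[OF finD])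
  also have "\<dots> \<le> card D * N" using sum_bounded_above[of D "\<lambda>xy. card (B xy)" N] B by simp
  also have "\<dots> \<le> M * M * N"
  proof -
    have "card D \<le> card (Z \<times> Z)" using assms(4) by (intro card_mono) (auto simp: D_def)
    also have "\<dots> \<le> M * M" using assms(5) by (simp add: card_cartesian_product mult_le_mono)
    finally show ?thesis by (rule mult_le_mono1)
  qed
  finally have "\<not> {..M * M * N} \<subseteq> (\<Union>xy\<in>D. B xy)"
    using card_mono[of "\<Union>xy\<in>D. B xy" "{..M * M * N}"] finD B by auto
  then obtain q where q: "q \<le> M * M * N" "q \<notin> (\<Union>xy\<in>D. B xy)" by auto
  then have "inj_on (power_form \<iota> X q) Z"
    by (intro inj_onI) (auto simp: B_def D_def)
  then show ?thesis using q(1) by blast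
qed

text \<open>The product of the conditions for all candidate forms is chosen before \<open>F\<close>
  and \<open>Z\<close>. The a priori bound \<open>M\<close> fixes how many forms are enough to
  separate the points, but it does not enter the final bound.\<close>

lemma generic_fibre_card:
  fixes \<phi> :: "'w \<Rightarrow> ('w \<Rightarrow> complex) \<times> ('x \<Rightarrow> complex) \<Rightarrow> complex"
  assumes "finite Q" "finite W" "finite X" "Q \<inter> W = {}" "card W = N" "card X = N"
    and "\<And>w. w \<in> W \<Longrightarrow> \<phi> w \<in> bounded_polys Q X 1 d"
  shows "\<exists>p. line_poly p \<and> (\<exists>F. p F \<noteq> 0) \<and>
    (\<forall>F Z. p F \<noteq> 0 \<longrightarrow> finite Z \<longrightarrow> card Z \<le> M \<longrightarrow>
      (\<forall>x\<in>Z. (\<forall>i. i \<notin> X \<longrightarrow> x i = 0) \<and> (\<forall>w\<in>W. F w = \<phi> w (F, x))) \<longrightarrow> card Z \<le> (d + 1) ^ N)"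
proof -
  obtain \<iota> where i: "inj_on \<iota> X" "\<iota> ` X \<subseteq> {..<N}"
    using ex_bij_betw_finite_nat[OF assms(3)] assms(6)
    by (metis atLeast0LessThan bij_betw_imp_inj_on bij_betw_imp_surj_on order_refl)
  have "\<exists>p. line_poly p \<and> (\<exists>F. p F \<noteq> 0) \<and> (\<forall>F Z. p F \<noteq> 0 \<longrightarrow>
      (\<forall>x\<in>Z. \<forall>w\<in>W. F w = \<phi> w (F, x)) \<longrightarrow> card (power_form \<iota> X q ` Z) \<le> (d + 1) ^ N)" for q
    by (rule generic_fibre_card_image[of Q W X N \<phi> d "power_form \<iota> X q"])
      (use assms power_form_bounded_polys in auto)
  then obtain p where p: "\<And>q. line_poly (p q)" "\<And>q. \<exists>F. p q F \<noteq> 0"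
    "\<And>q F Z. p q F \<noteq> 0 \<Longrightarrow> (\<forall>x\<in>Z. \<forall>w\<in>W. F w = \<phi> w (F, x)) \<Longrightarrow>
      card (power_form \<iota> X q ` Z) \<le> (d + 1) ^ N"
    by metis
  let ?P = "\<lambda>F. \<Prod>q\<in>{..M * M * N}. p q F"
  have "card Z \<le> (d + 1) ^ N"
    if F: "?P F \<noteq> 0" and Z: "finite Z" "card Z \<le> M"
      "\<forall>x\<in>Z. (\<forall>i. i \<notin> X \<longrightarrow> x i = 0) \<and> (\<forall>w\<in>W. F w = \<phi> w (F, x))" for F Z
  proof -
    obtain q where q: "q \<le> M * M * N" "inj_on (power_form \<iota> X q) Z"
      using ex_separating_power_form[OF assms(3) i Z(1,2)] Z(3) by blast
    have "p q F \<noteq> 0" using F q(1) by auto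
    then show ?thesis using p(3)[of q F Z] Z(3) card_image[OF q(2)] by simp
  qed
  moreover have "\<exists>F. ?P F \<noteq> 0"
    using ex_common_nonvanishing[of "{..M * M * N}" p] p(1,2) by auto
  moreover have "line_poly ?P" by (intro line_poly_prod p(1))
  ultimately show ?thesis by (intro exI[of _ ?P]) blast
qed

section \<open>Charts on the space of lines\<close>

lemma finite_monomials: "finite (monomials n d)"
proof -
  have "Poly_Mapping.lookup ` monomials n d \<subseteq> exponents_upto {..n} d"
    by (auto simp: monomials_def exponents_upto_def in_keys_iff)
  then have "finite (Poly_Mapping.lookup ` monomials n d)"
    using finite_exponents_upto[of "{..n}"] finite_subset by blast
  then show ?thesis
    by (rule finite_imageD) (simp add: inj_on_def)
qed

lemma lookup_eq_0_outside:
  "Poly_Mapping.keys m \<subseteq> I \<Longrightarrow> i \<notin> I \<Longrightarrow> Poly_Mapping.lookup m i = 0"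
  by (auto simp: in_keys_iff)

text \<open>The coefficients at these monomials are the ones determined by a contained chart line;
  they play the role of \<open>W\<close> in the elimination.\<close>

definition edge_monomials :: "nat \<Rightarrow> nat \<Rightarrow> nat \<Rightarrow> nat \<Rightarrow> (nat \<Rightarrow>\<^sub>0 nat) set" where
  "edge_monomials n d i j = {m \<in> monomials n d. Poly_Mapping.keys m \<subseteq> {i, j}}"

lemma edge_monomials_sum:
  assumes "m \<in> edge_monomials n d i j" "i \<le> n" "j \<le> n" "i \<noteq> j"
  shows "Poly_Mapping.lookup m i + Poly_Mapping.lookup m j = d"
proof -
  have "(\<Sum>l\<le>n. Poly_Mapping.lookup m l) = (\<Sum>l\<in>{i, j}. Poly_Mapping.lookup m l)"
    using assms lookup_eq_0_outside[of m "{i, j}"]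
    by (intro sum.mono_neutral_right) (auto simp: edge_monomials_def)
  then show ?thesis
    using assms by (simp add: edge_monomials_def monomials_def)
qed

lemma edge_monomials_eqI:
  assumes "m \<in> edge_monomials n d i j" "m' \<in> edge_monomials n d i j" "i \<le> n" "j \<le> n" "i \<noteq> j"
    and "Poly_Mapping.lookup m i = Poly_Mapping.lookup m' i"
  shows "m = m'"
proof (rule poly_mapping_eqI)
  fix l
  show "Poly_Mapping.lookup m l = Poly_Mapping.lookup m' l"
  proof (cases "l \<in> {i, j}")
    case True
    then show ?thesis
      using edge_monomials_sum[OF assms(1,3-5)] edge_monomials_sum[OF assms(2,3-5)] assms(6) by auto
  next
    case False
    then show ?thesis
      using assms(1,2) lookup_eq_0_outside[of m "{i, j}" l] lookup_eq_0_outside[of m' "{i, j}" l]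
      by (simp add: edge_monomials_def)
  qed
qed

lemma card_edge_monomials:
  assumes "i \<le> n" "j \<le> n" "i \<noteq> j"
  shows "card (edge_monomials n d i j) = d + 1"
proof -
  have "bij_betw (\<lambda>m. Poly_Mapping.lookup m i) (edge_monomials n d i j) {..d}"
  proof (rule bij_betwI')
    fix k assume "k \<in> {..d}"
    define m where "m = Poly_Mapping.single i k + Poly_Mapping.single j (d - k)"
    have look: "Poly_Mapping.lookup m l = (if l = i then k else if l = j then d - k else 0)" for l
      using assms by (simp add: m_def lookup_add lookup_single when_def)
    have keys: "Poly_Mapping.keys m \<subseteq> {i, j}"
      by (auto simp: in_keys_iff look split: if_splits)
    have "(\<Sum>l\<le>n. Poly_Mapping.lookup m l) = (\<Sum>l\<in>{i, j}. Poly_Mapping.lookup m l)"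
      using assms lookup_eq_0_outside[OF keys] by (intro sum.mono_neutral_right) auto
    also have "\<dots> = d" using assms \<open>k \<in> {..d}\<close> by (simp add: look)
    finally have "m \<in> edge_monomials n d i j"
      using keys assms by (auto simp: edge_monomials_def monomials_def)
    then show "\<exists>m\<in>edge_monomials n d i j. k = Poly_Mapping.lookup m i"
      using look by (intro bexI[of _ m]) auto
  next
    fix m assume "m \<in> edge_monomials n d i j"
    from edge_monomials_sum[OF this assms] show "Poly_Mapping.lookup m i \<in> {..d}" by simp
  qed (use edge_monomials_eqI[OF _ _ assms] in blast)
  then show ?thesis using bij_betw_same_card by fastforce
qed

section \<open>Affine charts for lines\<close>

definition chart_index :: "nat \<Rightarrow> nat \<Rightarrow> nat \<Rightarrow> (nat \<times> bool) set" where
  "chart_index n i j = ({..n} - {i, j}) \<times> UNIV"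

text \<open>The Boolean tells the two spanning vectors apart: \<open>False\<close> goes with the
  vector normalised at \<open>i\<close>, \<open>True\<close> with the one normalised at
  \<open>j\<close>, for which the indices are swapped.\<close>

definition chart_vec :: "nat \<Rightarrow> nat \<Rightarrow> nat \<Rightarrow> bool \<Rightarrow> (nat \<times> bool \<Rightarrow> complex) \<Rightarrow> nat \<Rightarrow> complex" where
  "chart_vec n i j b x l = (if l = i then 1 else if l = j then 0 else if l \<le> n then x (l, b) else 0)"

definition chart_line :: "nat \<Rightarrow> nat \<Rightarrow> nat \<Rightarrow> (nat \<times> bool \<Rightarrow> complex) \<Rightarrow> (nat \<Rightarrow> complex) set set" where
  "chart_line n i j x = proj_line_through (chart_vec n i j False x) (chart_vec n j i True x)"

text \<open>This is the dimension of the Grassmannian. It agrees with the number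
  \<open>d + 1\<close> of edge monomials when \<open>d = 2 * n - 3\<close>, as the elimination
  requires.\<close>

lemma card_chart_index:
  assumes "i \<le> n" "j \<le> n" "i \<noteq> j"
  shows "card (chart_index n i j) = 2 * n - 2"
proof -
  have "card ({..n} - {i, j}) = n - 1"
    using assms by (subst card_Diff_subset) auto
  then show ?thesis by (simp add: chart_index_def card_cartesian_product)
qed

section \<open>Restricting forms to a chart line\<close>

text \<open>The monomial \<open>m\<close> at the point \<open>s u + v\<close> of the chart line, as a polynomial in \<open>s\<close>.\<close>

definition pencil_monomial ::
    "nat \<Rightarrow> nat \<Rightarrow> nat \<Rightarrow> (nat \<Rightarrow>\<^sub>0 nat) \<Rightarrow> (nat \<times> bool \<Rightarrow> complex) \<Rightarrow> complex poly" where
  "pencil_monomial n i j m x =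
     (\<Prod>l\<le>n. [:chart_vec n j i True x l, chart_vec n i j False x l:] ^ Poly_Mapping.lookup m l)"

text \<open>On the chart line, coordinate \<open>i\<close> is \<open>s\<close> and coordinate
  \<open>j\<close> is 1, whatever \<open>x\<close> is. Hence the edge monomials restrict to distinct
  powers of \<open>s\<close>, and the containment equations are already solved for their
  coefficients.\<close>

lemma pencil_monomial_edge:
  assumes "m \<in> edge_monomials n d i j" "i \<le> n" "j \<le> n" "i \<noteq> j"
  shows "pencil_monomial n i j m x = monom 1 (Poly_Mapping.lookup m i)"
proof -
  have "pencil_monomial n i j m x =
      (\<Prod>l\<in>{i, j}. [:chart_vec n j i True x l, chart_vec n i j False x l:] ^ Poly_Mapping.lookup m l)"
    unfolding pencil_monomial_def using assms
      lookup_eq_0_outside[of m "{i, j}"]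
    by (intro prod.mono_neutral_right) (auto simp: edge_monomials_def)
  also have "\<dots> = [:0, 1:] ^ Poly_Mapping.lookup m i"
    using assms by (simp add: chart_vec_def one_pCons[symmetric])
  also have "\<dots> = monom 1 (Poly_Mapping.lookup m i)"
    by (metis monom_altdef smult_1_left)
  finally show ?thesis .
qed

text \<open>The bound \<open>R\<close> concerns the degree in the chart coordinates
  \<open>x\<close>, not the degree in the variable \<open>s\<close>.\<close>

definition bounded_coeffs ::
    "'w set \<Rightarrow> 'x set \<Rightarrow> nat \<Rightarrow> (('x \<Rightarrow> complex) \<Rightarrow> complex poly) \<Rightarrow> bool" where
  "bounded_coeffs Q X R p \<longleftrightarrow> (\<forall>k. (\<lambda>(F, x). coeff (p x) k) \<in> bounded_polys Q X 0 R)"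

lemma bounded_coeffs_one: "bounded_coeffs Q X R (\<lambda>_. 1)"
  unfolding bounded_coeffs_def using bounded_polys_const by (auto simp: case_prod_unfold)

lemma bounded_coeffs_mult:
  assumes "bounded_coeffs Q X R p" "bounded_coeffs Q X R' q"
  shows "bounded_coeffs Q X (R + R') (\<lambda>x. p x * q x)"
  unfolding bounded_coeffs_def
proof
  fix k
  have "(\<lambda>(F, x). coeff (p x * q x) k) =
      (\<Sum>i\<le>k. (\<lambda>(F, x). coeff (p x) i) * (\<lambda>(F, x). coeff (q x) (k - i)))"
    by (auto simp: fun_eq_iff fun_space_sum_apply coeff_mult)
  also have "\<dots> \<in> bounded_polys Q X (0 + 0) (R + R')"
    using assms unfolding bounded_coeffs_def
    by (intro fun_space.span_sum bounded_polys_mult) auto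
  finally show "(\<lambda>(F, x). coeff (p x * q x) k) \<in> bounded_polys Q X 0 (R + R')" by simp
qed

lemma bounded_coeffs_power:
  assumes "bounded_coeffs Q X R p"
  shows "bounded_coeffs Q X (k * R) (\<lambda>x. p x ^ k)"
  by (induction k) (auto intro: bounded_coeffs_mult[OF assms] bounded_coeffs_one)

lemma bounded_coeffs_prod:
  assumes "\<And>a. a \<in> I \<Longrightarrow> bounded_coeffs Q X (R a) (p a)"
  shows "bounded_coeffs Q X (\<Sum>a\<in>I. R a) (\<lambda>x. \<Prod>a\<in>I. p a x)"
  using assms
  by (induction I rule: infinite_finite_induct)
    (auto intro: bounded_coeffs_mult bounded_coeffs_one)

lemma bounded_coeffs_pencil_monomial:
  assumes "m \<in> monomials n d"
  shows "bounded_coeffs Q (chart_index n i j) d (pencil_monomial n i j m)"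
proof -
  let ?X = "chart_index n i j"
  have fin: "finite ?X" by (simp add: chart_index_def)
  have vec: "(\<lambda>(F, x). chart_vec n a b c x l) \<in> bounded_polys Q ?X 0 1" if "{a, b} = {i, j}" for a b c l
  proof (cases "l \<noteq> a \<and> l \<noteq> b \<and> l \<le> n")
    case True
    then have "(l, c) \<in> ?X" using that by (auto simp: chart_index_def)
    then show ?thesis using True bounded_polys_var[OF fin] by (simp add: chart_vec_def)
  next
    case False
    then have "chart_vec n a b c x l = (if l = a then 1 else 0)" for x
      by (auto simp: chart_vec_def)
    then show ?thesis
      using bounded_polys_const[of "if l = a then 1 else 0"] by (simp only: case_prod_unfold)
  qed
  have "bounded_coeffs Q ?X 1 (\<lambda>x. [:chart_vec n j i True x l, chart_vec n i j False x l:])" for l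
    unfolding bounded_coeffs_def
  proof
    fix k
    show "(\<lambda>(F, x). coeff [:chart_vec n j i True x l, chart_vec n i j False x l:] k)
        \<in> bounded_polys Q ?X 0 1"
    proof (cases k)
      case 0
      then show ?thesis using vec[of j i True l] by (simp add: insert_commute)
    next
      case (Suc k')
      then show ?thesis
        using vec[of i j False l] bounded_polys_const[of 0] by (cases k') (simp_all add: case_prod_unfold)
    qed
  qed
  then have "bounded_coeffs Q ?X (\<Sum>l\<le>n. Poly_Mapping.lookup m l * 1) (pencil_monomial n i j m)"
    unfolding pencil_monomial_def[abs_def]
    by (intro bounded_coeffs_prod bounded_coeffs_power)
  then show ?thesis using assms by (simp add: monomials_def)
qed

text \<open>The value forced on the coefficient at \<open>w\<close> when the restricted form has no
  term in the power \<open>lookup w i\<close> of \<open>s\<close>.\<close>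

definition edge_coeff ::
    "nat \<Rightarrow> nat \<Rightarrow> nat \<Rightarrow> nat \<Rightarrow> (nat \<Rightarrow>\<^sub>0 nat) \<Rightarrow>
      ((nat \<Rightarrow>\<^sub>0 nat) \<Rightarrow> complex) \<times> (nat \<times> bool \<Rightarrow> complex) \<Rightarrow> complex" where
  "edge_coeff n d i j w = (\<lambda>(F, x). - (\<Sum>m\<in>monomials n d - edge_monomials n d i j.
     F m * coeff (pencil_monomial n i j m x) (Poly_Mapping.lookup w i)))"

lemma edge_coeff_bounded:
  "edge_coeff n d i j w \<in>
     bounded_polys (monomials n d - edge_monomials n d i j) (chart_index n i j) 1 d"
proof -
  let ?Q = "monomials n d - edge_monomials n d i j"
  have "edge_coeff n d i j w = - (\<Sum>m\<in>?Q. (\<lambda>(F, x). F m) *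
      (\<lambda>(F, x). coeff (pencil_monomial n i j m x) (Poly_Mapping.lookup w i)))"
    by (auto simp: fun_eq_iff edge_coeff_def fun_space_sum_apply)
  also have "\<dots> \<in> bounded_polys ?Q (chart_index n i j) (1 + 0) (0 + d)"
    using bounded_coeffs_pencil_monomial[of _ n d ?Q i j]
    by (intro fun_space.span_neg fun_space.span_sum bounded_polys_mult bounded_polys_param)
      (auto simp: finite_monomials bounded_coeffs_def)
  finally show ?thesis by simp
qed

lemma poly_eval_form:
  assumes "F \<in> forms n d"
  shows "poly_eval F y =
    (\<Sum>m\<in>monomials n d. Poly_Mapping.lookup F m * (\<Prod>l\<le>n. y l ^ Poly_Mapping.lookup m l))"
proof -
  have "(\<Prod>i\<in>Poly_Mapping.keys m. y i ^ Poly_Mapping.lookup m i) =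
      (\<Prod>l\<le>n. y l ^ Poly_Mapping.lookup m l)" if "m \<in> monomials n d" for m
    using that by (intro prod.mono_neutral_left) (auto simp: monomials_def in_keys_iff)
  then have "poly_eval F y = (\<Sum>m\<in>Poly_Mapping.keys F.
      Poly_Mapping.lookup F m * (\<Prod>l\<le>n. y l ^ Poly_Mapping.lookup m l))"
    using assms unfolding poly_eval_def forms_def by (intro sum.cong) auto
  also have "\<dots> = (\<Sum>m\<in>monomials n d. Poly_Mapping.lookup F m * (\<Prod>l\<le>n. y l ^ Poly_Mapping.lookup m l))"
    using assms finite_monomials
    by (intro sum.mono_neutral_left) (auto simp: forms_def in_keys_iff)
  finally show ?thesis .
qed

text \<open>Restricted to the points \<open>s u + v\<close>, the form is a polynomial in
  \<open>s\<close> that vanishes at every complex number, hence is zero. One of its coefficients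
  gives the equation.\<close>

lemma edge_coeff_eq:
  assumes F: "F \<in> forms n d" and line: "chart_line n i j x \<subseteq> hypersurface n F"
    and ij: "i \<le> n" "j \<le> n" "i \<noteq> j" and w: "w \<in> edge_monomials n d i j"
  shows "Poly_Mapping.lookup F w = edge_coeff n d i j w (Poly_Mapping.lookup F, x)"
proof -
  let ?W = "edge_monomials n d i j" and ?k = "Poly_Mapping.lookup w i"
  define P where "P = (\<Sum>m\<in>monomials n d. smult (Poly_Mapping.lookup F m) (pencil_monomial n i j m x))"
  have "poly P s = 0" for s
  proof -
    let ?y = "\<lambda>l. s * chart_vec n i j False x l + 1 * chart_vec n j i True x l"
    have "proj_point ?y \<in> chart_line n i j x"
      unfolding chart_line_def proj_line_through_def
      by (intro CollectI exI[of _ s] exI[of _ 1] conjI refl) simp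
    moreover have "?y \<in> proj_point ?y"
      unfolding proj_point_def by (intro CollectI exI[of _ 1]) simp
    ultimately have "poly_eval F ?y = 0"
      using line unfolding hypersurface_def by blast
    moreover have "poly P s = poly_eval F ?y"
      unfolding poly_eval_form[OF F] P_def
      by (simp add: poly_sum pencil_monomial_def poly_prod add.commute mult.commute)
    ultimately show ?thesis by simp
  qed
  then have "P = 0" using poly_all_0_iff_0 by blast
  then have "(\<Sum>m\<in>monomials n d. Poly_Mapping.lookup F m * coeff (pencil_monomial n i j m x) ?k) = 0"
    by (metis (no_types, lifting) P_def coeff_0 coeff_smult coeff_sum sum.cong)
  moreover have "?W \<subseteq> monomials n d" by (auto simp: edge_monomials_def)
  \<comment> \<open>Among the edge monomials only \<open>w\<close> restricts to this power of
    \<open>s\<close>.\<close>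
  moreover have "(\<Sum>m\<in>?W. Poly_Mapping.lookup F m * coeff (pencil_monomial n i j m x) ?k) =
      (\<Sum>m\<in>?W. if m = w then Poly_Mapping.lookup F m else 0)"
    using edge_monomials_eqI[OF _ w ij]
    by (intro sum.cong) (auto simp: pencil_monomial_edge[OF _ ij])
  moreover have "finite ?W" using finite_subset[OF _ finite_monomials] calculation by blast
  ultimately show ?thesis
    using w sum.subset_diff[of ?W "monomials n d"
        "\<lambda>m. Poly_Mapping.lookup F m * coeff (pencil_monomial n i j m x) ?k"] finite_monomials
    by (simp add: edge_coeff_def eq_neg_iff_add_eq_0 add.commute)
qed

section \<open>Change of spanning vectors and covering by charts\<close>

lemma proj_line_through_lincomb_subset:
  assumes "p * s - q * r \<noteq> 0"
  shows "proj_line_through (\<lambda>l. p * a l + q * b l) (\<lambda>l. r * a l + s * b l) \<subseteq> proj_line_through a b"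
proof
  fix P assume "P \<in> proj_line_through (\<lambda>l. p * a l + q * b l) (\<lambda>l. r * a l + s * b l)"
  then obtain c e where ce: "c \<noteq> 0 \<or> e \<noteq> 0"
    "P = proj_point (\<lambda>l. c * (p * a l + q * b l) + e * (r * a l + s * b l))"
    unfolding proj_line_through_def by auto
  \<comment> \<open>Cramer's rule: if both new coefficients vanished, the nonzero determinant would
    force \<open>c\<close> and \<open>e\<close> to vanish.\<close>
  have "(c * p + e * r) * s - (c * q + e * s) * r = c * (p * s - q * r)"
    "(c * q + e * s) * p - (c * p + e * r) * q = e * (p * s - q * r)"
    by (simp_all add: algebra_simps)
  then have "c * p + e * r \<noteq> 0 \<or> c * q + e * s \<noteq> 0"
    using ce(1) assms by auto
  moreover have "P = proj_point (\<lambda>l. (c * p + e * r) * a l + (c * q + e * s) * b l)"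
    unfolding ce(2) by (simp add: algebra_simps)
  ultimately show "P \<in> proj_line_through a b"
    unfolding proj_line_through_def by blast
qed

lemma proj_line_through_lincomb:
  assumes "p * s - q * r \<noteq> 0"
  shows "proj_line_through (\<lambda>l. p * a l + q * b l) (\<lambda>l. r * a l + s * b l) = proj_line_through a b"
proof
  let ?D = "p * s - q * r"
  let ?u = "\<lambda>l. p * a l + q * b l" and ?v = "\<lambda>l. r * a l + s * b l"
  \<comment> \<open>The inverse matrix recovers \<open>a\<close> and \<open>b\<close>, so the
    opposite inclusion is another instance of the previous lemma.\<close>
  have "s / ?D * ?u l + - q / ?D * ?v l = a l" for l
  proof -
    have "s / ?D * ?u l + - q / ?D * ?v l = (?D * a l) / ?D"
      by (simp add: add_divide_distrib[symmetric] diff_divide_distrib[symmetric] algebra_simps)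
    then show ?thesis using assms by simp
  qed
  moreover have "- r / ?D * ?u l + p / ?D * ?v l = b l" for l
  proof -
    have "- r / ?D * ?u l + p / ?D * ?v l = (?D * b l) / ?D"
      by (simp add: add_divide_distrib[symmetric] diff_divide_distrib[symmetric] algebra_simps)
    then show ?thesis using assms by simp
  qed
  moreover have "s / ?D * (p / ?D) - (- q / ?D) * (- r / ?D) = ?D / (?D * ?D)"
    by (simp add: diff_divide_distrib[symmetric] algebra_simps)
  then have "s / ?D * (p / ?D) - (- q / ?D) * (- r / ?D) \<noteq> 0"
    using assms by simp
  ultimately show "proj_line_through a b \<subseteq> proj_line_through ?u ?v"
    using proj_line_through_lincomb_subset[of "s / ?D" "p / ?D" "- q / ?D" "- r / ?D" ?u ?v] by simp
qed (rule proj_line_through_lincomb_subset[OF assms])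

text \<open>If all minors vanished, \<open>b\<close> would be the multiple of \<open>a\<close> by
  the ratio at a nonzero coordinate of \<open>a\<close>, and the two points would coincide.\<close>

lemma ex_nonzero_minor:
  assumes "a \<in> nonzero_vecs n" "b \<in> nonzero_vecs n" "proj_point a \<noteq> proj_point b"
  shows "\<exists>i\<le>n. \<exists>j\<le>n. a i * b j - a j * b i \<noteq> 0"
proof (rule ccontr)
  assume "\<not> ?thesis"
  then have minors: "a i * b j = a j * b i" if "i \<le> n" "j \<le> n" for i j
    using that by auto
  obtain i where i: "a i \<noteq> 0" "i \<le> n"
    using assms(1) by (auto simp: nonzero_vecs_def) (metis not_le)
  define c where "c = b i / a i"
  have b: "b j = c * a j" for j
  proof (cases "j \<le> n")
    case True
    then show ?thesis using minors[OF i(2) True] i by (simp add: c_def field_simps)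
  next
    case False
    then show ?thesis using assms by (simp add: nonzero_vecs_def)
  qed
  then have "c \<noteq> 0" using assms(2) by (auto simp: nonzero_vecs_def)
  have "proj_point a = proj_point b"
  proof (intro set_eqI iffI)
    fix z assume "z \<in> proj_point a"
    then obtain t where "t \<noteq> 0" "z = (\<lambda>l. t * a l)" by (auto simp: proj_point_def)
    then have "z = (\<lambda>l. t / c * b l)" "t / c \<noteq> 0" using \<open>c \<noteq> 0\<close> by (auto simp: b)
    then show "z \<in> proj_point b" unfolding proj_point_def by blast
  next
    fix z assume "z \<in> proj_point b"
    then obtain t where "t \<noteq> 0" "z = (\<lambda>l. t * b l)" by (auto simp: proj_point_def)
    then have "z = (\<lambda>l. t * c * a l)" "t * c \<noteq> 0" using \<open>c \<noteq> 0\<close> by (auto simp: b)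
    then show "z \<in> proj_point a" unfolding proj_point_def by blast
  qed
  then show False using assms(3) by simp
qed

text \<open>A nonzero minor can be turned into the identity block by changing the spanning vectors.
  Setting \<open>x\<close> to 0 off the chart index makes different coordinate functions differ at
  an index of the chart, as the separating forms need.\<close>

lemma ex_chart:
  assumes "L \<in> proj_lines n"
  shows "\<exists>i\<le>n. \<exists>j\<le>n. i \<noteq> j \<and> (\<exists>x. (\<forall>k. k \<notin> chart_index n i j \<longrightarrow> x k = 0) \<and> L = chart_line n i j x)"
proof -
  obtain a b where ab: "a \<in> nonzero_vecs n" "b \<in> nonzero_vecs n" "proj_point a \<noteq> proj_point b"
    "L = proj_line_through a b"
    using assms unfolding proj_lines_def by blast
  obtain i j where ij: "i \<le> n" "j \<le> n" "a i * b j - a j * b i \<noteq> 0"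
    using ex_nonzero_minor[OF ab(1-3)] by blast
  define D where "D = a i * b j - a j * b i"
  have "D \<noteq> 0" using ij by (simp add: D_def)
  \<comment> \<open>The coefficients of \<open>u\<close> and \<open>v\<close> come from the inverse
    of the minor at \<open>i\<close> and \<open>j\<close>.\<close>
  define u where "u l = b j / D * a l + - a j / D * b l" for l
  define v where "v l = - b i / D * a l + a i / D * b l" for l
  have "b j / D * (a i / D) - (- a j / D) * (- b i / D) = D / (D * D)"
    by (simp add: diff_divide_distrib[symmetric] D_def algebra_simps)
  then have det: "b j / D * (a i / D) - (- a j / D) * (- b i / D) \<noteq> 0" using \<open>D \<noteq> 0\<close> by simp
  have L: "L = proj_line_through u v"
    unfolding ab(4) u_def[abs_def] v_def[abs_def] by (rule proj_line_through_lincomb[OF det, symmetric])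
  have uv: "u j = 0" "v i = 0" by (simp_all add: u_def v_def)
  have "u i = D / D" "v j = D / D"
    by (simp_all add: u_def v_def D_def diff_divide_distrib[symmetric] add_divide_distrib[symmetric]
        algebra_simps)
  then have uv1: "u i = 1" "v j = 1" using \<open>D \<noteq> 0\<close> by auto
  have "u l = 0" "v l = 0" if "l > n" for l
    using ab that by (auto simp: u_def v_def nonzero_vecs_def)
  note uv = uv uv1 this
  have "i \<noteq> j" using ij by auto
  define x where "x = (\<lambda>(l, c). if l \<in> {..n} - {i, j} then if c then v l else u l else 0)"
  have "chart_vec n i j False x = u" "chart_vec n j i True x = v"
    using uv by (auto simp: chart_vec_def x_def fun_eq_iff)
  then have "L = chart_line n i j x" by (simp add: chart_line_def L)
  moreover have "\<forall>k. k \<notin> chart_index n i j \<longrightarrow> x k = 0"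
    by (auto simp: chart_index_def x_def)
  ultimately show ?thesis using ij(1,2) \<open>i \<noteq> j\<close> by blast
qed

section \<open>Nonvanishing of the genericity polynomial\<close>

lemma ex_poly_eval_nonzero:
  assumes "D \<noteq> 0" "\<And>m. m \<in> Poly_Mapping.keys D \<Longrightarrow> Poly_Mapping.keys m \<subseteq> I" "finite I"
  shows "\<exists>x. poly_eval D x \<noteq> 0"
proof -
  have eq: "poly_eval D x = (\<Sum>m\<in>Poly_Mapping.keys D. Poly_Mapping.lookup D m *
      (\<Prod>i\<in>I. x i ^ Poly_Mapping.lookup m i))" for x
    unfolding poly_eval_def
    by (intro sum.cong refl arg_cong2[where f = "(*)"] prod.mono_neutral_left)
      (use assms(2,3) in \<open>auto simp: in_keys_iff\<close>)
  obtain m0 where m0: "m0 \<in> Poly_Mapping.keys D"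
    using assms(1) by fastforce
  show ?thesis
    unfolding eq
  proof (rule ex_nonvanishing_monomial_sum[OF assms(3) _ _ m0])
    fix m m' assume *: "m \<in> Poly_Mapping.keys D" "m' \<in> Poly_Mapping.keys D"
      "\<And>i. i \<in> I \<Longrightarrow> Poly_Mapping.lookup m i = Poly_Mapping.lookup m' i"
    show "m = m'"
    proof (rule poly_mapping_eqI)
      fix i
      show "Poly_Mapping.lookup m i = Poly_Mapping.lookup m' i"
        using *(3) lookup_eq_0_outside[OF assms(2)] *(1,2) by (cases "i \<in> I") auto
    qed
  qed (use m0 in \<open>auto simp: in_keys_iff\<close>)
qed

lemma line_poly_poly_eval: "line_poly (poly_eval D)"
  unfolding poly_eval_def[abs_def]
  by (intro line_poly_sum line_poly_mult line_poly_prod line_poly_power line_poly_const line_poly_coord)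

section \<open>Counting lines\<close>

text \<open>The condition \<open>p\<close> is tested at an arbitrary coefficient function
  \<open>G\<close> that agrees with \<open>F\<close> on the relevant monomials, because a common
  nonvanishing point need not have finite support.\<close>

lemma generic_chart_line_count:
  assumes "i \<le> n" "j \<le> n" "i \<noteq> j" "2 * n - 2 = d + 1"
  shows "\<exists>p. line_poly p \<and> (\<exists>G. p G \<noteq> 0) \<and>
    (\<forall>F\<in>forms n d. \<forall>G. p G \<noteq> 0 \<longrightarrow> (\<forall>m\<in>monomials n d. Poly_Mapping.lookup F m = G m) \<longrightarrow>
      finite (lines_in_hypersurface n F) \<longrightarrow> card (lines_in_hypersurface n F) \<le> M \<longrightarrow>
      card {L \<in> lines_in_hypersurface n F.
          \<exists>x. (\<forall>k. k \<notin> chart_index n i j \<longrightarrow> x k = 0) \<and> L = chart_line n i j x}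
        \<le> (d + 1) ^ (2 * n - 2))"
proof -
  let ?W = "edge_monomials n d i j" and ?X = "chart_index n i j"
  let ?Q = "monomials n d - ?W"
  have W: "?W \<subseteq> monomials n d" by (auto simp: edge_monomials_def)
  have "\<exists>p. line_poly p \<and> (\<exists>F. p F \<noteq> 0) \<and>
    (\<forall>F Z. p F \<noteq> 0 \<longrightarrow> finite Z \<longrightarrow> card Z \<le> M \<longrightarrow>
      (\<forall>x\<in>Z. (\<forall>k. k \<notin> ?X \<longrightarrow> x k = 0) \<and> (\<forall>w\<in>?W. F w = edge_coeff n d i j w (F, x))) \<longrightarrow>
      card Z \<le> (d + 1) ^ (2 * n - 2))"
  proof (rule generic_fibre_card[of ?Q])
    show "finite ?W" using W finite_monomials finite_subset by blast
    show "card ?W = 2 * n - 2" using card_edge_monomials[OF assms(1-3)] assms(4) by simp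
    show "card ?X = 2 * n - 2" by (rule card_chart_index[OF assms(1-3)])
    show "finite ?X" by (simp add: chart_index_def)
    show "edge_coeff n d i j w \<in> bounded_polys ?Q ?X 1 d" for w by (rule edge_coeff_bounded)
  qed (auto simp: finite_monomials)
  then obtain p where p: "line_poly p \<and> (\<exists>F. p F \<noteq> 0) \<and>
    (\<forall>F Z. p F \<noteq> 0 \<longrightarrow> finite Z \<longrightarrow> card Z \<le> M \<longrightarrow>
      (\<forall>x\<in>Z. (\<forall>k. k \<notin> ?X \<longrightarrow> x k = 0) \<and> (\<forall>w\<in>?W. F w = edge_coeff n d i j w (F, x))) \<longrightarrow>
      card Z \<le> (d + 1) ^ (2 * n - 2))" ..
  note p_bound = p[THEN conjunct2, THEN conjunct2, THEN spec, THEN spec, THEN mp, THEN mp, THEN mp, THEN mp]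
  have "card {L \<in> lines_in_hypersurface n F. \<exists>x. (\<forall>k. k \<notin> ?X \<longrightarrow> x k = 0) \<and> L = chart_line n i j x}
      \<le> (d + 1) ^ (2 * n - 2)"
    if F: "F \<in> forms n d" and G: "p G \<noteq> 0" "\<forall>m\<in>monomials n d. Poly_Mapping.lookup F m = G m"
      and fin: "finite (lines_in_hypersurface n F)" "card (lines_in_hypersurface n F) \<le> M" for F G
  proof -
    define Y where "Y = {L \<in> lines_in_hypersurface n F.
        \<exists>x. (\<forall>k. k \<notin> ?X \<longrightarrow> x k = 0) \<and> L = chart_line n i j x}"
    have "\<forall>L\<in>Y. \<exists>x. (\<forall>k. k \<notin> ?X \<longrightarrow> x k = 0) \<and> L = chart_line n i j x"
      by (auto simp: Y_def)
    \<comment> \<open>One coordinate vector per line; it determines the line, so counting these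
      vectors counts the lines.\<close>
    then obtain \<xi> where \<xi>: "\<And>L. L \<in> Y \<Longrightarrow> (\<forall>k. k \<notin> ?X \<longrightarrow> \<xi> L k = 0) \<and> L = chart_line n i j (\<xi> L)"
      by metis
    then have "inj_on \<xi> Y" by (metis inj_onI)
    have "Y \<subseteq> lines_in_hypersurface n F" by (auto simp: Y_def)
    then have Y: "finite Y" "card Y \<le> M"
      using fin card_mono[of "lines_in_hypersurface n F" Y] finite_subset by auto
    have "card (\<xi> ` Y) \<le> (d + 1) ^ (2 * n - 2)"
    proof (rule p_bound[OF G(1)])
      show "\<forall>x\<in>\<xi> ` Y. (\<forall>k. k \<notin> ?X \<longrightarrow> x k = 0) \<and> (\<forall>w\<in>?W. G w = edge_coeff n d i j w (G, x))"
      proof (intro ballI conjI)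
        fix x w assume x: "x \<in> \<xi> ` Y" and w: "w \<in> ?W"
        then have "chart_line n i j x \<subseteq> hypersurface n F"
          using \<xi> by (force simp: Y_def lines_in_hypersurface_def)
        then have "Poly_Mapping.lookup F w = edge_coeff n d i j w (Poly_Mapping.lookup F, x)"
          by (intro edge_coeff_eq F assms(1-3) w)
        also have "\<dots> = edge_coeff n d i j w (G, x)"
          using G(2) by (simp add: edge_coeff_def)
        finally show "G w = edge_coeff n d i j w (G, x)" using G(2) W w by auto
      qed (use \<xi> in auto)
    qed (use Y card_image_le[OF Y(1), of \<xi>] in auto)
    then show ?thesis
      using card_image[OF \<open>inj_on \<xi> Y\<close>] by (simp add: Y_def)
  qed
  then show ?thesis
    using p[THEN conjunct1] p[THEN conjunct2, THEN conjunct1] by (intro exI[of _ p] conjI ballI allI impI) auto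
qed

lemma ex_form_with_coefficients:
  obtains F where "F \<in> forms n d" "\<And>m. m \<in> monomials n d \<Longrightarrow> Poly_Mapping.lookup F m = G m"
proof -
  have "finite {m. (if m \<in> monomials n d then G m else 0) \<noteq> 0}"
    using finite_monomials[of n d] by (rule rev_finite_subset) auto
  then have look: "Poly_Mapping.lookup (Abs_poly_mapping (\<lambda>m. if m \<in> monomials n d then G m else 0)) =
      (\<lambda>m. if m \<in> monomials n d then G m else 0)"
    by (rule lookup_Abs_poly_mapping)
  show ?thesis
    by (rule that[of "Abs_poly_mapping (\<lambda>m. if m \<in> monomials n d then G m else 0)"])
      (auto simp: forms_def in_keys_iff look split: if_splits)
qed

text \<open>A single form satisfying the genericity condition \<open>D\<close> and all chart
  conditions suffices. Its line count is \<open>M\<close> itself, which also serves as the a priori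
  bound in each chart.\<close>

lemma generic_line_count_le:
  assumes "n \<ge> 2" "is_generic_line_count n (2 * n - 3) M"
  shows "M \<le> (n + 1) ^ 2 * (2 * n - 2) ^ (2 * n - 2)"
proof -
  define d where "d = 2 * n - 3"
  have d: "2 * n - 2 = d + 1" using assms(1) by (simp add: d_def)
  obtain D :: "(nat \<Rightarrow>\<^sub>0 nat) cpoly" where D: "D \<noteq> 0"
    "\<And>m. m \<in> Poly_Mapping.keys D \<Longrightarrow> Poly_Mapping.keys m \<subseteq> monomials n d"
    "\<And>F. F \<in> forms n d \<Longrightarrow> F \<noteq> 0 \<Longrightarrow> poly_eval D (Poly_Mapping.lookup F) \<noteq> 0 \<Longrightarrow>
      finite (lines_in_hypersurface n F) \<and> card (lines_in_hypersurface n F) = M"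
    using assms(2) unfolding is_generic_line_count_def generic_hypersurface_def d_def by blast
  define I where "I = {(i, j) \<in> {..n} \<times> {..n}. i \<noteq> j}"
  have finI: "finite I" by (rule finite_subset[of _ "{..n} \<times> {..n}"]) (auto simp: I_def)
  define Y where "Y F = (\<lambda>(i, j). {L \<in> lines_in_hypersurface n F.
      \<exists>x. (\<forall>k. k \<notin> chart_index n i j \<longrightarrow> x k = 0) \<and> L = chart_line n i j x})" for F
  define good where "good ij p \<longleftrightarrow> line_poly p \<and> (\<exists>G. p G \<noteq> 0) \<and>
    (\<forall>F\<in>forms n d. \<forall>G. p G \<noteq> 0 \<longrightarrow> (\<forall>m\<in>monomials n d. Poly_Mapping.lookup F m = G m) \<longrightarrow>
      finite (lines_in_hypersurface n F) \<longrightarrow> card (lines_in_hypersurface n F) \<le> M \<longrightarrow>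
      card (Y F ij) \<le> (d + 1) ^ (2 * n - 2))" for ij p
  have "\<exists>p. good ij p" if "ij \<in> I" for ij
    using that generic_chart_line_count[OF _ _ _ d, of "fst ij" "snd ij" M]
    unfolding good_def Y_def I_def case_prod_unfold by (simp add: mem_Times_iff)
  then obtain p where good: "\<And>ij. ij \<in> I \<Longrightarrow> good ij (p ij)" by metis
  have p: "line_poly (p ij)" "\<exists>G. p ij G \<noteq> 0" if "ij \<in> I" for ij
    using good[OF that, unfolded good_def, THEN conjunct1]
      good[OF that, unfolded good_def, THEN conjunct2, THEN conjunct1] .
  obtain w where w: "w \<in> monomials n d"
  proof -
    have "edge_monomials n d 0 1 \<noteq> {}"
      using card_edge_monomials[of 0 n 1 d] assms(1) by force
    then show ?thesis using that by (auto simp: edge_monomials_def)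
  qed
  \<comment> \<open>The coordinate at \<open>w\<close> is included to ensure that the resulting form
    is nonzero.\<close>
  have "\<exists>G. \<forall>f\<in>{poly_eval D, \<lambda>G. G w} \<union> p ` I. f G \<noteq> 0"
  proof (rule ex_common_nonvanishing)
    have "\<exists>G. poly_eval D G \<noteq> 0"
      by (rule ex_poly_eval_nonzero[OF D(1,2) finite_monomials])
    moreover have "\<exists>G :: (nat \<Rightarrow>\<^sub>0 nat) \<Rightarrow> complex. G w \<noteq> 0"
      by (intro exI[of _ "\<lambda>_. 1"]) simp
    ultimately show "\<exists>G. f G \<noteq> 0" if "f \<in> {poly_eval D, \<lambda>G. G w} \<union> p ` I" for f
      using that p(2) by auto
    show "line_poly f" if "f \<in> {poly_eval D, \<lambda>G. G w} \<union> p ` I" for f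
      using that p(1) line_poly_poly_eval line_poly_coord by auto
  qed (use finI in auto)
  then obtain G where G: "poly_eval D G \<noteq> 0" "G w \<noteq> 0" "\<And>ij. ij \<in> I \<Longrightarrow> p ij G \<noteq> 0"
    by auto
  obtain F where F: "F \<in> forms n d" "\<And>m. m \<in> monomials n d \<Longrightarrow> Poly_Mapping.lookup F m = G m"
    using ex_form_with_coefficients[of n d G] by blast
  have "F \<noteq> 0" using F(2)[OF w] G(2) by auto
  moreover have "poly_eval D (Poly_Mapping.lookup F) = poly_eval D G"
    unfolding poly_eval_def using D(2) F(2)
    by (intro sum.cong refl arg_cong2[where f = "(*)"] prod.cong) (auto simp: subset_iff)
  ultimately have lines: "finite (lines_in_hypersurface n F)" "card (lines_in_hypersurface n F) = M"
    using D(3)[OF F(1)] G(1) by auto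
  have "lines_in_hypersurface n F \<subseteq> (\<Union>ij\<in>I. Y F ij)"
  proof
    fix L assume L: "L \<in> lines_in_hypersurface n F"
    then have "L \<in> proj_lines n" by (simp add: lines_in_hypersurface_def)
    from ex_chart[OF this] L show "L \<in> (\<Union>ij\<in>I. Y F ij)" by (auto simp: I_def Y_def)
  qed
  moreover have "finite (\<Union>ij\<in>I. Y F ij)"
    using lines(1) by (rule rev_finite_subset) (auto simp: Y_def)
  ultimately have "M \<le> card (\<Union>ij\<in>I. Y F ij)"
    using lines(2) card_mono by blast
  also have "\<dots> \<le> (\<Sum>ij\<in>I. card (Y F ij))" by (rule card_UN_le[OF finI])
  also have "\<dots> \<le> card I * (d + 1) ^ (2 * n - 2)"
  proof -
    have "card (Y F ij) \<le> (d + 1) ^ (2 * n - 2)" if "ij \<in> I" for ij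
      using good[OF that] F G(3)[OF that] lines unfolding good_def by simp
    then show ?thesis
      using sum_bounded_above[of I "\<lambda>ij. card (Y F ij)" "(d + 1) ^ (2 * n - 2)"] by simp
  qed
  also have "\<dots> \<le> (n + 1) ^ 2 * (d + 1) ^ (2 * n - 2)"
  proof -
    have "card I \<le> card ({..n} \<times> {..n})" by (intro card_mono) (auto simp: I_def)
    also have "\<dots> = (n + 1) ^ 2" by (simp add: card_cartesian_product power2_eq_square)
    finally show ?thesis by (rule mult_le_mono1)
  qed
  finally show ?thesis by (simp add: d)
qed

section \<open>The asymptotic estimate\<close>

theorem corollary4:
  fixes C :: "nat \<Rightarrow> nat"
  assumes "\<And>n. n \<ge> 2 \<Longrightarrow> is_generic_line_count n (2 * n - 3) (C n)"
  shows "\<exists>g :: nat \<Rightarrow> real. g \<in> O(\<lambda>n. real n) \<and>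
           (\<forall>\<^sub>F n in sequentially. ln (real (C n)) \<le> 2 * real n * ln (real n) + g n)"
proof (intro exI[of _ "\<lambda>n. (2 + 2 * ln 2) * real n"] conjI)
  \<comment> \<open>The first 2 absorbs the logarithm of \<open>(n + 1) ^ 2\<close>, by
    \<open>ln (1 + n) \<le> n\<close>; the term \<open>2 * ln 2\<close> comes from the factor 2 in
    the base of \<open>(2 * n) ^ (2 * n)\<close>.\<close>
  show "(\<lambda>n. (2 + 2 * ln 2) * real n) \<in> O(\<lambda>n. real n)"
    by (intro bigoI[of _ "2 + 2 * ln 2"] always_eventually) (auto simp: abs_mult)
  show "\<forall>\<^sub>F n in sequentially. ln (real (C n)) \<le> 2 * real n * ln (real n) + (2 + 2 * ln 2) * real n"
    using eventually_ge_at_top[of 2]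
  proof eventually_elim
    case (elim n)
    have "C n \<le> (n + 1) ^ 2 * (2 * n - 2) ^ (2 * n - 2)"
      using generic_line_count_le assms elim by blast
    also have "\<dots> \<le> (n + 1) ^ 2 * (2 * n) ^ (2 * n)"
    proof (intro mult_le_mono2)
      have "(2 * n - 2) ^ (2 * n - 2) \<le> (2 * n) ^ (2 * n - 2)" by (intro power_mono) auto
      also have "\<dots> \<le> (2 * n) ^ (2 * n)" using elim by (intro power_increasing) auto
      finally show "(2 * n - 2) ^ (2 * n - 2) \<le> (2 * n) ^ (2 * n)" .
    qed
    finally have "real (C n) \<le> real ((n + 1) ^ 2 * (2 * n) ^ (2 * n))"
      by (simp only: of_nat_le_iff)
    then have le: "real (C n) \<le> (1 + real n) ^ 2 * (2 * real n) ^ (2 * n)"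
      by (simp add: add.commute)
    have "ln (real (C n)) \<le> ln ((1 + real n) ^ 2 * (2 * real n) ^ (2 * n))"
    \<comment> \<open>Since \<open>ln 0\<close> is 0 by convention, a zero count is covered by
      showing that the bound is at least 1.\<close>
    proof (cases "C n = 0")
      case True
      have "1 * 1 \<le> (1 + real n) ^ 2 * (2 * real n) ^ (2 * n)"
        using elim by (intro mult_mono one_le_power) auto
      then show ?thesis using True by simp
    qed (use le in \<open>simp add: ln_mono\<close>)
    also have "\<dots> = 2 * ln (1 + real n) + 2 * real n * (ln 2 + ln (real n))"
      using elim by (simp add: ln_mult ln_realpow distrib_left)
    also have "\<dots> \<le> 2 * real n + 2 * real n * (ln 2 + ln (real n))"
      using ln_add_one_self_le_self[of "real n"] by simp
    finally show ?case by (simp add: algebra_simps)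
  qed
qed

end
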